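(* Let $\lambda\neq0$ be a complex number and let $(\nu,z)\in\mathbb B_p^s\times\mathbb R^{N-1}$ (complexified), $(\nu,z)\ne0$. Then $\lambda$ is an eigenvalue of $\mathbf L_\Pi$ with eigenfunction $(\nu,z)$ if and only if $\rho:=(\lambda\mathcal I-\mathcal V)(\mathbf U(\nu),z)$ belongs to $\mathrm{Ker}(\mathcal M(\lambda))$, where $\mathcal M(\lambda)=\mathcal I-\mathcal F(\lambda\mathcal I-\mathcal V)^{-1}:\mathrm{Range}(\mathcal F)\to\mathrm{Range}(\mathcal F)$.
   Context: Setting. Fix $N\ge1$, $T>0$, reals $\alpha<\beta$, $k\in\mathbb R^N$, $\mathbf A,\mathbf B\in\mathbb R^{N\times N}$, a linear functional $\mathbf Mx=\sum_{j=1}^N m_{j-1}x_j$ with $m_0\neq0$, $0<s<1$, $1<p<\min\{1/s,1/(1-s)\}$, $0<\sigma\le T/3$. Put $\mathbb L_p(a,b)=(L_p(a,b))^N$, $\mathbb W^1_p(a,b)=(W^1_p(a,b))^N$, $\mathbb L_p=\mathbb L_p(-2T,0)$, and $\mathbb W_p^s(a,b)=(W_p^s(a,b))^N$, where $W_p^s(a,b)$ is the Sobolev–Slobodeckij space with norm $\|\varphi\|_{L_p(a,b)}+\big(\int_a^b\int_a^b\frac{|\varphi(t)-\varphi(\xi)|^p}{|t-\xi|^{1+sp}}d\xi dt\big)^{1/p}$. Let $\mathbb B_p^s$ be the space of $\varphi\in\mathbb L_p$ with $\varphi|_{(-T-\sigma,0)}\in\mathbb W_p^s(-T-\sigma,0)$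 and norm $\|\varphi\|_{\mathbb L_p}+\|\varphi\|_{\mathbb W_p^s(-T-\sigma,0)}$. All spaces are complexified when $\lambda$ is complex. Periodic solution (standing assumption). Hysteresis: for $g\in C[0,T_1]$, $X_t=\{t'\in(0,t]:g(t')\in\{\alpha,\beta\}\}$, $z=\mathcal H(g)$ is given by $z(0)=1$ if $g(0)<\beta$, $z(0)=-1$ if $g(0)\ge\beta$, and for $t>0$ $z(t)=z(0)$ if $X_t=\emptyset$, $z(t)=1$ (resp. $-1$) if $g(\max X_t)=\alpha$ (resp. $\beta$). $(\varphi_\alpha,x_\alpha)\in\mathbb B_p^s\times\mathbb R^N$ is such that the unique solution $u_{\rm per}$ of $u'(t)=k\mathcal H(\mathbf Mu)(t)-\mathbf Bu(t)+\mathbf Au(t-2T)$ ($t>0$), $u=\varphi_\alpha$ on $(-2T,0)$, $u(0+)=x_\alpha$ is $2T$-periodic ($u_{\rm per}(2T)=x_\alpha$, $u_{\rm per}(2T+\xi)=\varphi_\alpha(\xi)$ for $\xi\in(-2T,0)$, equal hysteresis values at $0$ and $2T$), and: (1) $\mathbf Mx_\alpha=\alpha$; (2) the discontinuities of $\mathcal H(\mathbf Mu_{\rm per})$ along the period are exactly $t=T$ (where $\mathbf Mu_{\rm per}=\beta$) and $t=2T$ (where $\mathbf Mu_{\rm per}=\alpha$); (3) $\varphi_\alpha'(\theta)=-\varphi_\alpha'(\theta+T)$ for $\theta\in(-2T,-T)$ (automatically $\varphi_\alpha\in C^\infty[-2T,-T]\cap C^\infty[-T,0]$); (4) $\frac{d}{dt}\mathbf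 Mu_{\rm per}(T-)\ne0\neq\frac{d}{dt}\mathbf Mu_{\rm per}(2T-)$. Operator $\mathbf L_\Pi$. With $\varphi_\alpha'(-T-)$ the left limit at $-T$, put $c[\nu,y]=-\dfrac{\mathbf M\big[\int_{-T}^0e^{\mathbf B\xi}\mathbf A\nu(\xi-T)d\xi+e^{-\mathbf BT}y\big]}{\mathbf M[\varphi_\alpha'(-T-)]}$ and define $\mathbf L:\mathbb B_p^s\times\mathbb R^N\to\mathbb B_p^s$ by $\mathbf L[\nu,y](\theta)=c[\nu,y]\varphi_\alpha'(\theta+T)+\nu(\theta+T)$ for $\theta\in(-2T,-T)$, and $\mathbf L[\nu,y](\theta)=c[\nu,y]\varphi_\alpha'(\theta-T)+\int_{-T}^\theta e^{\mathbf B(\xi-\theta)}\mathbf A\nu(\xi-T)d\xi+e^{-\mathbf B(\theta+T)}y$ for $\theta\in(-T,0)$. Let $\mathbf E^{\mathbb R}(x_1,\dots,x_N)=(x_2,\dots,x_N)$ and $D\mathbf Rz=\big(-\frac1{m_0}\sum_{j=1}^{N-1}m_jz_j,\,z\big)$, $z\in\mathbb R^{N-1}$. Then $\mathbf L_\Pi:\mathbb B_p^s\times\mathbb R^{N-1}\to\mathbb B_p^s\times\mathbb R^{N-1}$ is $\mathbf L_\Pi[\nu,z]=\big(\mathbf L[\nu,D\mathbf Rz],\ \mathbf E^{\mathbb R}\mathbf L[\nu,D\mathbf Rz](0)\big)$, the value at $0$ being the trace of the part on $(-T,0)$. Operators $\mathbf U,\mathcal V,\mathcal F$. $\mathbf U[\nu](\theta)=(\nu(\theta-T),\nu(\theta))$,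 $\theta\in(-T,0)$. On $\mathbb L_p(-T,0)\times\mathbb L_p(-T,0)\times\mathbb R^{N-1}$: $\mathcal V(\nu_1,\nu_2,z)=(\nu_2,\mathbf V\nu_1,0)$ with $\mathbf V\nu_1(\theta)=\int_{-T}^\theta e^{\mathbf B(\xi-\theta)}\mathbf A\nu_1(\xi)d\xi$; for $\lambda\ne0$ the operator $\lambda\mathcal I-\mathcal V$ is boundedly invertible there. $\mathcal F$ is the finite-rank operator $\mathcal F(\nu_1,\nu_2,z)=(f_1,f_2,\mathbf E^{\mathbb R}[(\mathbf V\nu_1)(0)+f_2(0)])$, where, for $\theta\in(-T,0)$, $f_1(\theta)=\kappa\,\varphi_\alpha'(\theta)$, $f_2(\theta)=\kappa\,\varphi_\alpha'(\theta-T)+e^{-\mathbf B(\theta+T)}D\mathbf Rz$, and $\kappa=-\dfrac{\mathbf M\int_{-T}^0e^{\mathbf B\xi}\mathbf A\nu_1(\xi)d\xi+\mathbf Me^{-\mathbf BT}D\mathbf Rz}{\mathbf M[\varphi_\alpha'(-T-)]}$. *)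

theory Defs
  imports "HOL-Analysis.Analysis"
begin

text \<open>
  Conventions.  Coordinates of \<open>\<real>\<^sup>N\<close> are indexed by a finite type \<open>'n\<close> (so \<open>N = CARD('n) \<ge> 1\<close> is arbitrary),
  with a distinguished index \<open>i1\<close> that plays the role of the coordinate number 1; the coefficient
  \<open>m\<^sub>0\<close> of \<open>\<^bold>M\<close> is then \<open>m $ i1\<close>.  Since index types are nonempty, \<open>\<real>\<^sup>N\<^sup>-\<^sup>1\<close>, the space of the vectors
  \<open>(x\<^sub>2, \<dots>, x\<^sub>N)\<close>, is represented by the vectors whose coordinate \<open>i1\<close> is 0; this includes \<open>N = 1\<close>.

  Elements of \<open>L\<^sub>p\<close> spaces are represented by functions on \<open>\<real>\<close>, of which only the values on the
  interval in question matter; equality of elements is equality almost everywhere on that interval.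
\<close>

section \<open>Function spaces\<close>

definition Lp :: "real \<Rightarrow> real \<Rightarrow> real \<Rightarrow> (real \<Rightarrow> 'a::real_normed_vector) set" where
  "Lp p a b = {f. f \<in> borel_measurable (lebesgue_on {a<..<b}) \<and>
                  integrable (lebesgue_on {a<..<b}) (\<lambda>t. norm (f t) powr p)}"

text \<open>Sobolev--Slobodeckij space: the elements of \<open>L\<^sub>p\<close> with finite Gagliardo seminorm.\<close>

definition Wsp :: "real \<Rightarrow> real \<Rightarrow> real \<Rightarrow> real \<Rightarrow> (real \<Rightarrow> 'a::real_normed_vector) set" where
  "Wsp s p a b = {f \<in> Lp p a b.
     (\<integral>\<^sup>+t. (\<integral>\<^sup>+\<xi>. ennreal (norm (f t - f \<xi>) powr p / \<bar>t - \<xi>\<bar> powr (1 + s * p))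
        \<partial>lebesgue_on {a<..<b}) \<partial>lebesgue_on {a<..<b}) < \<infinity>}"

definition LpN :: "real \<Rightarrow> real \<Rightarrow> real \<Rightarrow> (real \<Rightarrow> ('a::real_normed_vector)^'n) set" where
  "LpN p a b = {f. \<forall>i. (\<lambda>t. f t $ i) \<in> Lp p a b}"

definition WspN :: "real \<Rightarrow> real \<Rightarrow> real \<Rightarrow> real \<Rightarrow> (real \<Rightarrow> ('a::real_normed_vector)^'n) set" where
  "WspN s p a b = {f. \<forall>i. (\<lambda>t. f t $ i) \<in> Wsp s p a b}"

definition Bsp :: "real \<Rightarrow> real \<Rightarrow> real \<Rightarrow> real \<Rightarrow> (real \<Rightarrow> ('a::real_normed_vector)^'n) set" where
  "Bsp T \<sigma> s p = LpN p (- 2 * T) 0 \<inter> WspN s p (- T - \<sigma>) 0"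

text \<open>\<open>f\<close> is the absolutely continuous representative of an element of \<open>(W\<^sup>1\<^sub>p(a,b))\<^sup>N\<close>, with
  generalized derivative \<open>g\<close>.\<close>

definition W1p_deriv ::
  "real \<Rightarrow> real \<Rightarrow> real \<Rightarrow> (real \<Rightarrow> real^'n) \<Rightarrow> (real \<Rightarrow> real^'n) \<Rightarrow> bool" where
  "W1p_deriv p a b f g \<longleftrightarrow> g \<in> LpN p a b \<and>
     (\<forall>t\<in>{a..b}. f t = f a + (LINT \<xi>:{a<..<t}|lebesgue. g \<xi>))"

definition ae_eq :: "real \<Rightarrow> real \<Rightarrow> (real \<Rightarrow> 'a) \<Rightarrow> (real \<Rightarrow> 'a) \<Rightarrow> bool" where
  "ae_eq a b f g \<longleftrightarrow> (AE t in lebesgue_on {a<..<b}. f t = g t)"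

section \<open>Linear algebra\<close>

definition cvec :: "real^'n \<Rightarrow> complex^'n" where
  "cvec x = (\<chi> i. complex_of_real (x $ i))"

definition cmat :: "real^'n^'m \<Rightarrow> complex^'n^'m" where
  "cmat X = (\<chi> i j. complex_of_real (X $ i $ j))"

text \<open>The matrix exponential.  The powers are taken with respect to \<open>**\<close>; the operator \<open>^\<close> on
  \<open>real^'n^'n\<close> is the entrywise power.\<close>

definition mexp :: "real^'n^'n \<Rightarrow> real^'n^'n" where
  "mexp X = (\<Sum>k. (1 / fact k) *\<^sub>R (((**) X) ^^ k) (mat 1))"

text \<open>The functional \<open>\<^bold>M\<close>, on real and on complex vectors.\<close>

definition Mf :: "real^'n \<Rightarrow> ('a::real_vector)^'n \<Rightarrow> 'a" where
  "Mf m x = (\<Sum>j\<in>UNIV. (m $ j) *\<^sub>R (x $ j))"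

definition Zsp :: "'n \<Rightarrow> (complex^'n) set" where
  "Zsp i1 = {z. z $ i1 = 0}"

definition ER :: "'n \<Rightarrow> complex^'n \<Rightarrow> complex^'n" where
  "ER i1 x = (\<chi> i. if i = i1 then 0 else x $ i)"

definition DR :: "real^'n \<Rightarrow> 'n \<Rightarrow> complex^'n \<Rightarrow> complex^'n" where
  "DR m i1 z = (\<chi> i. if i = i1 then - (1 / complex_of_real (m $ i1)) *
                         (\<Sum>j\<in>UNIV - {i1}. complex_of_real (m $ j) * z $ j)
                     else z $ i)"

section \<open>Hysteresis and the periodic solution\<close>

definition switch_set :: "real \<Rightarrow> real \<Rightarrow> (real \<Rightarrow> real) \<Rightarrow> real \<Rightarrow> real set" where
  "switch_set \<alpha> \<beta> g t = {t'. 0 < t' \<and> t' \<le> t \<and> g t' \<in> {\<alpha>, \<beta>}}"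

text \<open>For continuous \<open>g\<close> a nonempty \<open>switch_set \<alpha> \<beta> g t\<close> contains its supremum, which is thus the
  maximum.\<close>

definition hyst :: "real \<Rightarrow> real \<Rightarrow> (real \<Rightarrow> real) \<Rightarrow> real \<Rightarrow> real" where
  "hyst \<alpha> \<beta> g t =
     (if switch_set \<alpha> \<beta> g t = {} then (if g 0 < \<beta> then 1 else -1)
      else if g (Sup (switch_set \<alpha> \<beta> g t)) = \<alpha> then 1 else -1)"

text \<open>On \<open>[0,\<infinity>)\<close> a solution is represented by its continuous representative, so that
  \<open>u 0\<close> is the trace \<open>u(0+)\<close>.\<close>

definition is_solution ::
  "real \<Rightarrow> real \<Rightarrow> real \<Rightarrow> real \<Rightarrow> real^'n \<Rightarrow> real^'n^'n \<Rightarrow> real^'n^'n \<Rightarrow> real^'n \<Rightarrow>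
   (real \<Rightarrow> real^'n) \<Rightarrow> real^'n \<Rightarrow> (real \<Rightarrow> real^'n) \<Rightarrow> bool" where
  "is_solution T p \<alpha> \<beta> k A B m \<phi> x u \<longleftrightarrow>
     (\<forall>\<theta>\<in>{- 2 * T<..<0}. u \<theta> = \<phi> \<theta>) \<and> u 0 = x \<and>
     (\<forall>T1>0. \<exists>g. W1p_deriv p 0 T1 u g \<and>
        (AE t in lebesgue_on {0<..<T1}.
           g t = hyst \<alpha> \<beta> (\<lambda>\<tau>. Mf m (u \<tau>)) t *\<^sub>R k - B *v u t + A *v u (t - 2 * T)))"

text \<open>The standing assumption on the periodic solution.  Since \<open>\<phi>\<^sub>\<alpha>\<close> agrees on \<open>(-2T,0)\<close> with the
  shifted solution, it is taken to be the continuous representative of its class.\<close>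

definition periodic_solution ::
  "real \<Rightarrow> real \<Rightarrow> real \<Rightarrow> real \<Rightarrow> real \<Rightarrow> real \<Rightarrow> real^'n \<Rightarrow> real^'n^'n \<Rightarrow> real^'n^'n \<Rightarrow>
   real^'n \<Rightarrow> (real \<Rightarrow> real^'n) \<Rightarrow> real^'n \<Rightarrow> (real \<Rightarrow> real^'n) \<Rightarrow> bool" where
  "periodic_solution T \<sigma> s p \<alpha> \<beta> k A B m \<phi>\<^sub>\<alpha> x\<^sub>\<alpha> u \<longleftrightarrow>
     (let Mu = (\<lambda>t. Mf m (u t)); z = hyst \<alpha> \<beta> Mu in
      \<phi>\<^sub>\<alpha> \<in> Bsp T \<sigma> s p \<and>
      is_solution T p \<alpha> \<beta> k A B m \<phi>\<^sub>\<alpha> x\<^sub>\<alpha> u \<and>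
      u (2 * T) = x\<^sub>\<alpha> \<and> (\<forall>\<xi>\<in>{- 2 * T<..<0}. u (2 * T + \<xi>) = \<phi>\<^sub>\<alpha> \<xi>) \<and> z 0 = z (2 * T) \<and>
      Mf m x\<^sub>\<alpha> = \<alpha> \<and>
      {t\<in>{0<..2 * T}. \<not> isCont z t} = {T, 2 * T} \<and> Mu T = \<beta> \<and> Mu (2 * T) = \<alpha> \<and>
      (\<forall>\<theta>\<in>{- 2 * T<..<- T}.
         vector_derivative \<phi>\<^sub>\<alpha> (at \<theta>) = - vector_derivative \<phi>\<^sub>\<alpha> (at (\<theta> + T))) \<and>
      (\<exists>d. d \<noteq> 0 \<and> (deriv Mu \<longlongrightarrow> d) (at_left T)) \<and>
      (\<exists>d. d \<noteq> 0 \<and> (deriv Mu \<longlongrightarrow> d) (at_left (2 * T))))"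

section \<open>The operator \<open>\<^bold>L\<^sub>\<Pi>\<close>\<close>

definition dphi :: "(real \<Rightarrow> real^'n) \<Rightarrow> real \<Rightarrow> complex^'n" where
  "dphi \<phi> \<theta> = cvec (vector_derivative \<phi> (at \<theta>))"

text \<open>The left limit \<open>\<phi>'(-T-)\<close>; \<open>\<phi>\<close> itself may have a corner at \<open>-T\<close>.\<close>

definition dphi_left :: "real \<Rightarrow> (real \<Rightarrow> real^'n) \<Rightarrow> complex^'n" where
  "dphi_left T \<phi> = Lim (at_left (- T)) (dphi \<phi>)"

definition trace0 :: "(real \<Rightarrow> complex^'n) \<Rightarrow> complex^'n" where
  "trace0 f = Lim (at_left 0) f"

definition c_coef :: "real \<Rightarrow> real^'n^'n \<Rightarrow> real^'n^'n \<Rightarrow> real^'n \<Rightarrow> (real \<Rightarrow> real^'n) \<Rightarrow>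
    (real \<Rightarrow> complex^'n) \<Rightarrow> complex^'n \<Rightarrow> complex" where
  "c_coef T A B m \<phi>\<^sub>\<alpha> \<nu> y =
     - Mf m ((LINT \<xi>:{- T<..<0}|lebesgue. cmat (mexp (\<xi> *\<^sub>R B)) *v (cmat A *v \<nu> (\<xi> - T)))
             + cmat (mexp (- T *\<^sub>R B)) *v y)
     / Mf m (dphi_left T \<phi>\<^sub>\<alpha>)"

definition L_op :: "real \<Rightarrow> real^'n^'n \<Rightarrow> real^'n^'n \<Rightarrow> real^'n \<Rightarrow> (real \<Rightarrow> real^'n) \<Rightarrow>
    (real \<Rightarrow> complex^'n) \<Rightarrow> complex^'n \<Rightarrow> real \<Rightarrow> complex^'n" where
  "L_op T A B m \<phi>\<^sub>\<alpha> \<nu> y \<theta> =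
     (if \<theta> < - T then c_coef T A B m \<phi>\<^sub>\<alpha> \<nu> y *s dphi \<phi>\<^sub>\<alpha> (\<theta> + T) + \<nu> (\<theta> + T)
      else c_coef T A B m \<phi>\<^sub>\<alpha> \<nu> y *s dphi \<phi>\<^sub>\<alpha> (\<theta> - T)
           + (LINT \<xi>:{- T<..<\<theta>}|lebesgue.
                cmat (mexp ((\<xi> - \<theta>) *\<^sub>R B)) *v (cmat A *v \<nu> (\<xi> - T)))
           + cmat (mexp (- (\<theta> + T) *\<^sub>R B)) *v y)"

definition L_Pi :: "real \<Rightarrow> real^'n^'n \<Rightarrow> real^'n^'n \<Rightarrow> real^'n \<Rightarrow> 'n \<Rightarrow> (real \<Rightarrow> real^'n) \<Rightarrow>
    (real \<Rightarrow> complex^'n) \<times> (complex^'n) \<Rightarrow> (real \<Rightarrow> complex^'n) \<times> (complex^'n)" where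
  "L_Pi T A B m i1 \<phi>\<^sub>\<alpha> = (\<lambda>(\<nu>, z).
     (L_op T A B m \<phi>\<^sub>\<alpha> \<nu> (DR m i1 z), ER i1 (trace0 (L_op T A B m \<phi>\<^sub>\<alpha> \<nu> (DR m i1 z)))))"

definition BZ_eq :: "real \<Rightarrow> (real \<Rightarrow> complex^'n) \<times> (complex^'n) \<Rightarrow>
    (real \<Rightarrow> complex^'n) \<times> (complex^'n) \<Rightarrow> bool" where
  "BZ_eq T = (\<lambda>(\<nu>, z) (\<nu>', z'). ae_eq (- 2 * T) 0 \<nu> \<nu>' \<and> z = z')"

definition eigenpair_L_Pi :: "real \<Rightarrow> real \<Rightarrow> real \<Rightarrow> real \<Rightarrow> real^'n^'n \<Rightarrow> real^'n^'n \<Rightarrow> real^'n \<Rightarrow> 'n \<Rightarrow>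
    (real \<Rightarrow> real^'n) \<Rightarrow> complex \<Rightarrow> (real \<Rightarrow> complex^'n) \<times> (complex^'n) \<Rightarrow> bool" where
  "eigenpair_L_Pi T \<sigma> s p A B m i1 \<phi>\<^sub>\<alpha> lam = (\<lambda>(\<nu>, z).
     (\<nu>, z) \<in> Bsp T \<sigma> s p \<times> Zsp i1 \<and> \<not> BZ_eq T (\<nu>, z) (\<lambda>_. 0, 0) \<and>
     BZ_eq T (L_Pi T A B m i1 \<phi>\<^sub>\<alpha> (\<nu>, z)) (\<lambda>\<theta>. lam *s \<nu> \<theta>, lam *s z))"

section \<open>The operators \<open>\<^bold>U\<close>, \<open>\<V>\<close>, \<open>\<F>\<close>, \<open>\<M>(\<lambda>)\<close>\<close>

type_synonym 'n state = "((real \<Rightarrow> complex^'n) \<times> (real \<Rightarrow> complex^'n)) \<times> (complex^'n)"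

definition Xsp :: "real \<Rightarrow> real \<Rightarrow> 'n::finite \<Rightarrow> 'n state set" where
  "Xsp T p i1 = (LpN p (- T) 0 \<times> LpN p (- T) 0) \<times> Zsp i1"

definition X_eq :: "real \<Rightarrow> 'n::finite state \<Rightarrow> 'n state \<Rightarrow> bool" where
  "X_eq T = (\<lambda>((\<nu>1, \<nu>2), z) ((\<mu>1, \<mu>2), w).
     ae_eq (- T) 0 \<nu>1 \<mu>1 \<and> ae_eq (- T) 0 \<nu>2 \<mu>2 \<and> z = w)"

definition X_scale :: "complex \<Rightarrow> 'n::finite state \<Rightarrow> 'n state" where
  "X_scale lam = (\<lambda>((\<nu>1, \<nu>2), z). ((\<lambda>\<theta>. lam *s \<nu>1 \<theta>, \<lambda>\<theta>. lam *s \<nu>2 \<theta>), lam *s z))"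

definition U_op :: "real \<Rightarrow> (real \<Rightarrow> complex^'n) \<Rightarrow> (real \<Rightarrow> complex^'n) \<times> (real \<Rightarrow> complex^'n)" where
  "U_op T \<nu> = (\<lambda>\<theta>. \<nu> (\<theta> - T), \<nu>)"

definition V_op :: "real \<Rightarrow> real^'n^'n \<Rightarrow> real^'n^'n \<Rightarrow> (real \<Rightarrow> complex^'n) \<Rightarrow> real \<Rightarrow> complex^'n" where
  "V_op T A B \<nu>1 \<theta> =
     (LINT \<xi>:{- T<..<\<theta>}|lebesgue. cmat (mexp ((\<xi> - \<theta>) *\<^sub>R B)) *v (cmat A *v \<nu>1 \<xi>))"

definition VV_op :: "real \<Rightarrow> real^'n^'n \<Rightarrow> real^'n^'n \<Rightarrow> 'n state \<Rightarrow> 'n state" where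
  "VV_op T A B = (\<lambda>((\<nu>1, \<nu>2), z). ((\<nu>2, V_op T A B \<nu>1), 0))"

definition kappa :: "real \<Rightarrow> real^'n^'n \<Rightarrow> real^'n^'n \<Rightarrow> real^'n \<Rightarrow> 'n \<Rightarrow> (real \<Rightarrow> real^'n) \<Rightarrow>
    (real \<Rightarrow> complex^'n) \<Rightarrow> complex^'n \<Rightarrow> complex" where
  "kappa T A B m i1 \<phi>\<^sub>\<alpha> \<nu>1 z =
     - (Mf m (LINT \<xi>:{- T<..<0}|lebesgue. cmat (mexp (\<xi> *\<^sub>R B)) *v (cmat A *v \<nu>1 \<xi>))
        + Mf m (cmat (mexp (- T *\<^sub>R B)) *v DR m i1 z))
     / Mf m (dphi_left T \<phi>\<^sub>\<alpha>)"

text \<open>The value \<open>f2(0)\<close> is a trace, since \<open>\<phi>\<^sub>\<alpha>'(-T)\<close> only exists as a left limit.\<close>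

definition FF_op :: "real \<Rightarrow> real^'n^'n \<Rightarrow> real^'n^'n \<Rightarrow> real^'n \<Rightarrow> 'n \<Rightarrow> (real \<Rightarrow> real^'n) \<Rightarrow>
    'n state \<Rightarrow> 'n state" where
  "FF_op T A B m i1 \<phi>\<^sub>\<alpha> = (\<lambda>((\<nu>1, \<nu>2), z).
     let \<kappa> = kappa T A B m i1 \<phi>\<^sub>\<alpha> \<nu>1 z;
         f1 = (\<lambda>\<theta>. \<kappa> *s dphi \<phi>\<^sub>\<alpha> \<theta>);
         f2 = (\<lambda>\<theta>. \<kappa> *s dphi \<phi>\<^sub>\<alpha> (\<theta> - T) + cmat (mexp (- (\<theta> + T) *\<^sub>R B)) *v DR m i1 z)
     in ((f1, f2), ER i1 (V_op T A B \<nu>1 0 + trace0 f2)))"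

definition Range_FF :: "real \<Rightarrow> real \<Rightarrow> real^'n^'n \<Rightarrow> real^'n^'n \<Rightarrow> real^'n \<Rightarrow> 'n \<Rightarrow>
    (real \<Rightarrow> real^'n) \<Rightarrow> 'n state set" where
  "Range_FF T p A B m i1 \<phi>\<^sub>\<alpha> =
     {\<rho> \<in> Xsp T p i1. \<exists>w \<in> Xsp T p i1. X_eq T \<rho> (FF_op T A B m i1 \<phi>\<^sub>\<alpha> w)}"

definition lam_minus_V :: "real \<Rightarrow> real^'n^'n \<Rightarrow> real^'n^'n \<Rightarrow> complex \<Rightarrow> 'n state \<Rightarrow> 'n state" where
  "lam_minus_V T A B lam w = X_scale lam w - VV_op T A B w"

text \<open>The inverse of \<open>\<lambda>\<I> - \<V>\<close> on \<open>Xsp\<close>: for \<open>\<lambda> \<noteq> 0\<close> the element chosen exists and is unique up to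
  equality almost everywhere.\<close>

definition resolvent_V :: "real \<Rightarrow> real \<Rightarrow> real^'n^'n \<Rightarrow> real^'n^'n \<Rightarrow> 'n \<Rightarrow> complex \<Rightarrow>
    'n state \<Rightarrow> 'n state" where
  "resolvent_V T p A B i1 lam \<rho> =
     (SOME w. w \<in> Xsp T p i1 \<and> X_eq T (lam_minus_V T A B lam w) \<rho>)"

definition MM_op :: "real \<Rightarrow> real \<Rightarrow> real^'n^'n \<Rightarrow> real^'n^'n \<Rightarrow> real^'n \<Rightarrow> 'n \<Rightarrow>
    (real \<Rightarrow> real^'n) \<Rightarrow> complex \<Rightarrow> 'n state \<Rightarrow> 'n state" where
  "MM_op T p A B m i1 \<phi>\<^sub>\<alpha> lam \<rho> =
     \<rho> - FF_op T A B m i1 \<phi>\<^sub>\<alpha> (resolvent_V T p A B i1 lam \<rho>)"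

definition Ker_MM :: "real \<Rightarrow> real \<Rightarrow> real^'n^'n \<Rightarrow> real^'n^'n \<Rightarrow> real^'n \<Rightarrow> 'n \<Rightarrow>
    (real \<Rightarrow> real^'n) \<Rightarrow> complex \<Rightarrow> 'n state set" where
  "Ker_MM T p A B m i1 \<phi>\<^sub>\<alpha> lam =
     {\<rho> \<in> Range_FF T p A B m i1 \<phi>\<^sub>\<alpha>.
        X_eq T (MM_op T p A B m i1 \<phi>\<^sub>\<alpha> lam \<rho>) ((\<lambda>_. 0, \<lambda>_. 0), 0)}"

end

theory Submission
  imports Defs
begin

text \<open>
  Let \<open>w = (\<^bold>U(\<nu>), z)\<close>.  Up to a shift of the piece on \<open>(-2T,-T)\<close>, \<open>\<^bold>L\<^sub>\<Pi>\<close> is \<open>\<V> + \<F>\<close>, so the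
  eigenvalue equation reads \<open>(\<lambda>\<I> - \<V>)w = \<F>w\<close>, that is, \<open>\<rho> = \<F>(\<lambda>\<I> - \<V>)\<^sup>-\<^sup>1\<rho>\<close>.  Two analytic points
  enter.  The resolvent returns \<open>w\<close> up to null sets because the Volterra equation \<open>\<lambda>\<^sup>2\<delta> = \<^bold>V\<delta>\<close> has
  only the trivial solution.  The trace of \<open>\<^bold>L[\<nu>,y]\<close> at \<open>0\<close> splits into the value of \<open>\<^bold>V\<nu>\<^sub>1\<close> and the
  trace of \<open>f\<^sub>2\<close> because \<open>\<phi>\<^sub>\<alpha>'(-T-)\<close> exists: the hysteresis is constant on \<open>(0,T)\<close>, where by
  periodicity \<open>u(t-2T) = u(t)\<close>, so \<open>u\<close> solves a linear ordinary differential equation there.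
\<close>

section \<open>Matrix exponential and Lebesgue spaces\<close>

text \<open>The powers of \<open>B\<close> grow at most geometrically, so each entry is a power
  series in \<open>t\<close> that converges everywhere.\<close>

lemma continuous_on_mexp_line:
  fixes B :: "real^'n^'n"
  shows "continuous_on S (\<lambda>t. mexp (t *\<^sub>R B))"
proof -
  have bl: "bounded_linear ((**) B :: real^'n^'n \<Rightarrow> real^'n^'n)"
    by (intro linear_conv_bounded_linear[THEN iffD1] linearI)
      (simp_all add: matrix_add_ldistrib matrix_scalar_ac scalar_matrix_assoc)
  define P where "P k = (((**) B) ^^ k) (mat 1 :: real^'n^'n)" for k
  obtain K where K: "K > 0" "\<And>x::real^'n^'n. norm (B ** x) \<le> norm x * K"
    using bounded_linear.pos_bounded[OF bl] by blast
  \<comment> \<open>\<open>norm (P 0)\<close> is the norm of the identity matrix, which need not be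
    1 for the Euclidean norm on matrices.\<close>
  have P: "norm (P k) \<le> norm (P 0) * K ^ k" for k
  proof (induction k)
    case (Suc k)
    have "norm (P (Suc k)) \<le> norm (P k) * K" using K(2)[of "P k"] by (simp add: P_def)
    also have "\<dots> \<le> norm (P 0) * K ^ k * K" using Suc K(1) by (intro mult_right_mono) auto
    finally show ?case by (simp add: ac_simps)
  qed simp
  have pow: "(((**) (t *\<^sub>R B)) ^^ k) (mat 1) = t ^ k *\<^sub>R P k" for t k
  proof (induction k)
    case (Suc k)
    have "(t *\<^sub>R B) ** (t ^ k *\<^sub>R P k) = t ^ Suc k *\<^sub>R (B ** P k)"
      by (simp add: scalar_matrix_assoc[symmetric] matrix_scalar_ac)
    then show ?case by (simp add: Suc P_def)
  qed (simp add: P_def)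
  \<comment> \<open>The majorant is the exponential series of
    \<open>\<bar>t\<bar> * K\<close>.\<close>
  have smn: "summable (\<lambda>k. norm ((t ^ k / fact k) *\<^sub>R P k))" for t
  proof (rule summable_comparison_test[OF exI[of _ 0]], intro allI impI)
    fix k :: nat
    have "\<bar>t\<bar> ^ k / fact k * norm (P k) \<le> \<bar>t\<bar> ^ k / fact k * (norm (P 0) * K ^ k)"
      by (intro mult_left_mono P) auto
    also have "\<dots> = norm (P 0) * (inverse (fact k) * (\<bar>t\<bar> * K) ^ k)"
      by (simp add: field_simps)
    finally show "norm (norm ((t ^ k / fact k) *\<^sub>R P k)) \<le> norm (P 0) * (inverse (fact k) * (\<bar>t\<bar> * K) ^ k)"
      by (simp add: power_abs)
  next
    show "summable (\<lambda>k. norm (P 0) * (inverse (fact k) * (\<bar>t\<bar> * K) ^ k))"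
      by (intro summable_mult summable_exp)
  qed
  have sm: "summable (\<lambda>k. (t ^ k / fact k) *\<^sub>R P k)" for t
    by (rule summable_norm_cancel[OF smn])
  have entry_sm: "summable (\<lambda>k. P k $ i $ j / fact k * t ^ k)" for i j t
    using bounded_linear.summable[OF bounded_linear_compose[OF bounded_linear_vec_nth bounded_linear_vec_nth] sm, of t i j]
    by (simp add: ac_simps)
  have entry: "mexp (t *\<^sub>R B) $ i $ j = (\<Sum>k. P k $ i $ j / fact k * t ^ k)" for i j t
  proof -
    have "mexp (t *\<^sub>R B) = (\<Sum>k. (t ^ k / fact k) *\<^sub>R P k)"
      by (simp add: mexp_def pow)
    then show ?thesis
      using bounded_linear.suminf[OF bounded_linear_compose[OF bounded_linear_vec_nth bounded_linear_vec_nth] sm, of t i j]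
      by (simp add: ac_simps)
  qed
  \<comment> \<open>Convergence at \<open>\<bar>t\<bar> + 1\<close> puts \<open>t\<close> strictly
    inside the disc of convergence.\<close>
  have "isCont (\<lambda>t. mexp (t *\<^sub>R B) $ i $ j) t" for i j t
    unfolding entry by (rule isCont_powser[where K = "\<bar>t\<bar> + 1", OF entry_sm]) auto
  then have "continuous_on S (\<lambda>t. \<chi> i j. mexp (t *\<^sub>R B) $ i $ j)"
    by (intro continuous_on_vec_lambda) (auto intro: continuous_at_imp_continuous_on)
  then show ?thesis by simp
qed

text \<open>In finite dimension bilinearity over the reals already gives boundedness; the continuity
  and norm estimates for the kernels rest on this.\<close>

lemma bounded_bilinear_cmat_mult:
  "bounded_bilinear (\<lambda>(X::real^'n^'m) (v::complex^'n). cmat X *v v)"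
  by (simp add: bilinear_conv_bounded_bilinear[symmetric] bilinear_def linear_iff cmat_def vec_eq_iff
      matrix_vector_mult_def algebra_simps sum.distrib scaleR_sum_right scaleR_conv_of_real[symmetric])

lemma bounded_bilinear_kernel:
  "bounded_bilinear (\<lambda>(X::real^'n^'m) (v::complex^'k). cmat X *v (cmat (A::real^'k^'n) *v v))"
  by (rule bounded_bilinear.comp[OF bounded_bilinear_cmat_mult bounded_linear_ident
      bounded_bilinear.bounded_linear_right[OF bounded_bilinear_cmat_mult], unfolded o_def])

lemma sum_axis_nth: "(\<Sum>i\<in>UNIV. axis i (x $ i)) = (x :: 'a::comm_monoid_add^'n)"
  by (simp add: vec_eq_iff axis_def)

lemma bounded_linear_axis: "bounded_linear (axis i :: 'a::euclidean_space \<Rightarrow> 'a^'n)"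
  by (simp add: linear_conv_bounded_linear[symmetric] linear_iff vec_eq_iff axis_def)

section \<open>Lebesgue spaces on bounded intervals\<close>

lemma finite_measure_lebesgue_on_Ioo: "finite_measure (lebesgue_on {a<..<b::real})"
  using emeasure_bounded_finite[of "{a<..<b}"]
  by (intro finite_measureI) (simp add: emeasure_restrict_space)

text \<open>The interval has finite measure, so \<open>1 + norm (f t) powr p\<close> is an
  integrable majorant: the 1 serves where the norm is at most 1, the power elsewhere.\<close>

lemma Lp_imp_integrable:
  fixes f :: "real \<Rightarrow> 'a::euclidean_space"
  assumes "f \<in> Lp p a b" "1 \<le> p"
  shows "integrable (lebesgue_on {a<..<b}) f"
proof (rule Bochner_Integration.integrable_bound)
  show "integrable (lebesgue_on {a<..<b}) (\<lambda>t. 1 + norm (f t) powr p)"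
    using assms by (intro Bochner_Integration.integrable_add finite_measure.integrable_const
      finite_measure_lebesgue_on_Ioo) (auto simp: Lp_def)
  show "f \<in> borel_measurable (lebesgue_on {a<..<b})" using assms by (simp add: Lp_def)
  have "norm (f t) \<le> norm (1 + norm (f t) powr p)" for t
  proof (cases "norm (f t) \<le> 1")
    case False
    then have "norm (f t) powr 1 \<le> norm (f t) powr p" using assms by (intro powr_mono) auto
    then show ?thesis using False by simp
  next
    case True
    then show ?thesis using powr_ge_zero[of "norm (f t)" p] unfolding real_norm_def by linarith
  qed
  then show "AE t in lebesgue_on {a<..<b}. norm (f t) \<le> norm (1 + norm (f t) powr p)" by simp
qed

lemma LpN_imp_set_integrable:
  fixes f :: "real \<Rightarrow> 'a::euclidean_space^'n"
  assumes "f \<in> LpN p a b" "1 \<le> p" "{c<..<d} \<subseteq> {a<..<b}"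
  shows "set_integrable lebesgue {c<..<d} f"
proof -
  have "integrable (lebesgue_on {a<..<b}) (\<lambda>t. \<Sum>i\<in>UNIV. axis i (f t $ i))"
    using assms by (intro Bochner_Integration.integrable_sum integrable_bounded_linear[OF bounded_linear_axis]
      Lp_imp_integrable) (auto simp: LpN_def)
  then have "set_integrable lebesgue {a<..<b} f"
    unfolding sum_axis_nth set_integrable_def by (subst (asm) integrable_restrict_space) auto
  then show ?thesis by (rule set_integrable_subset) (use assms in auto)
qed

lemma continuous_on_imp_LpN:
  fixes f :: "real \<Rightarrow> 'a::euclidean_space^'n"
  assumes f: "continuous_on {a..b} f" and p: "0 \<le> p"
  shows "f \<in> LpN p a b"
proof -
  have "(\<lambda>t. f t $ i) \<in> Lp p a b" for i
  proof -
    have c: "continuous_on {a..b} (\<lambda>t. f t $ i)" by (intro continuous_intros f)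
    then have m: "(\<lambda>t. f t $ i) \<in> borel_measurable (lebesgue_on {a<..<b})"
      by (intro continuous_imp_measurable_on_sets_lebesgue)
        (auto intro: continuous_on_subset)
    have "bounded ((\<lambda>t. f t $ i) ` {a..b})"
      by (intro compact_imp_bounded compact_continuous_image c) auto
    then obtain M where M: "\<And>t. t \<in> {a..b} \<Longrightarrow> norm (f t $ i) \<le> M" unfolding bounded_iff by blast
    have "integrable (lebesgue_on {a<..<b}) (\<lambda>t. norm (f t $ i) powr p)"
    proof (rule finite_measure.integrable_const_bound[OF finite_measure_lebesgue_on_Ioo])
      show "AE t in lebesgue_on {a<..<b}. norm (norm (f t $ i) powr p) \<le> M powr p"
        by (intro AE_I2) (auto intro!: powr_mono2 p M)
      show "(\<lambda>t. norm (f t $ i) powr p) \<in> borel_measurable (lebesgue_on {a<..<b})"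
        using m by measurable
    qed
    then show ?thesis using m by (simp add: Lp_def)
  qed
  then show ?thesis by (simp add: LpN_def)
qed

section \<open>Shifts and a Volterra inequality\<close>

text \<open>The exceptional set moves with the translation and stays null. This allows functions on
  \<open>(-2T,-T)\<close> to be compared on \<open>(-T,0)\<close>.\<close>

lemma AE_lebesgue_shift:
  assumes "AE t::real in lebesgue. P t"
  shows "AE t in lebesgue. P (t + c)"
proof -
  obtain N where N: "N \<in> null_sets lebesgue" "\<And>t. t \<in> space lebesgue - N \<Longrightarrow> P t"
    using AE_E3[OF assms] by blast
  have "negligible ((+) (- c) ` N)"
    using N(1) by (intro negligible_translation) (simp add: negligible_iff_null_sets)
  then have "(+) (- c) ` N \<in> null_sets lebesgue"
    by (simp add: negligible_iff_null_sets)
  moreover have "t \<in> (+) (- c) ` N" if "\<not> P (t + c)" for t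
    using N(2)[of "t + c"] that by (intro image_eqI[of _ _ "t + c"]) auto
  ultimately show ?thesis by (intro AE_I') auto
qed

lemma ae_eq_iff: "ae_eq a b f g \<longleftrightarrow> (AE t in lebesgue. t \<in> {a<..<b} \<longrightarrow> f t = g t)"
  by (simp add: ae_eq_def AE_restrict_space_iff)

text \<open>The two open subintervals miss only the point \<open>b\<close>, a null set.\<close>

lemma ae_eq_split:
  assumes "a < b" "b < c"
  shows "ae_eq a c f g \<longleftrightarrow> ae_eq a b f g \<and> ae_eq b c f g"
proof
  assume "ae_eq a c f g"
  then show "ae_eq a b f g \<and> ae_eq b c f g"
    unfolding ae_eq_iff using assms by (auto elim!: eventually_mono)
next
  assume *: "ae_eq a b f g \<and> ae_eq b c f g"
  have "AE t in lebesgue. t \<noteq> b"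
    by (rule AE_completion, rule AE_lborel_singleton)
  with *[THEN conjunct1, unfolded ae_eq_iff] *[THEN conjunct2, unfolded ae_eq_iff]
  show "ae_eq a c f g" unfolding ae_eq_iff
    by eventually_elim auto
qed

lemma ae_eq_shift:
  "ae_eq a b (\<lambda>t. f (t - c)) (\<lambda>t. g (t - c)) \<longleftrightarrow> ae_eq (a - c) (b - c) f g"
proof
  assume "ae_eq a b (\<lambda>t. f (t - c)) (\<lambda>t. g (t - c))"
  from AE_lebesgue_shift[OF this[unfolded ae_eq_iff], of c]
  show "ae_eq (a - c) (b - c) f g" by (simp add: ae_eq_iff algebra_simps)
next
  assume "ae_eq (a - c) (b - c) f g"
  from AE_lebesgue_shift[OF this[unfolded ae_eq_iff], of "- c"]
  show "ae_eq a b (\<lambda>t. f (t - c)) (\<lambda>t. g (t - c))" by (simp add: ae_eq_iff algebra_simps)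
qed

text \<open>Extension by zero with the indicator moves the claim to the whole line, where Lebesgue
  measure is translation invariant.\<close>

lemma Lp_shift:
  assumes "f \<in> Lp p a b"
  shows "(\<lambda>t. f (t - c)) \<in> Lp p (a + c) (b + c)"
proof -
  have ind: "indicator {a + c<..<b + c} t = (indicator {a<..<b} (t - c) :: real)" for t
    by (auto simp: indicator_def)
  have "(\<lambda>t. t - c) \<in> lebesgue \<rightarrow>\<^sub>M lebesgue"
    using lebesgue_affine_measurable[of "\<lambda>_. 1" "- c"] by simp
  moreover have "(\<lambda>t. indicator {a<..<b} t *\<^sub>R f t) \<in> borel_measurable lebesgue"
    using assms by (simp add: Lp_def borel_measurable_restrict_space_iff)
  ultimately have "(\<lambda>t. indicator {a<..<b} (t - c) *\<^sub>R f (t - c)) \<in> borel_measurable lebesgue"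
    by (rule measurable_compose)
  moreover have "integrable lebesgue (\<lambda>t. indicator {a<..<b} (t - c) *\<^sub>R norm (f (t - c)) powr p)"
  proof -
    have "integrable lebesgue (\<lambda>t. indicator {a<..<b} t *\<^sub>R norm (f t) powr p)"
      using assms by (simp add: Lp_def integrable_restrict_space)
    then obtain I where "has_bochner_integral lebesgue (\<lambda>t. indicator {a<..<b} t *\<^sub>R norm (f t) powr p) I"
      by (auto simp only: integrable.simps)
    then have "has_bochner_integral lebesgue (\<lambda>t. indicator {a<..<b} (t - c) *\<^sub>R norm (f (t - c)) powr p) I"
      by (subst (asm) has_bochner_integral_lebesgue_real_affine_iff[of 1 _ _ "- c"]) simp_all
    then show ?thesis by (rule integrable.intros)
  qed
  ultimately show ?thesis
    by (simp add: Lp_def borel_measurable_restrict_space_iff integrable_restrict_space ind)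
qed

lemma Lp_subset:
  assumes "{c<..<d} \<subseteq> {a<..<b}"
  shows "Lp p a b \<subseteq> Lp p c d"
proof
  fix f assume f: "f \<in> Lp p a b"
  have "set_integrable lebesgue {a<..<b} (\<lambda>t. norm (f t) powr p)"
    using f by (simp add: Lp_def set_integrable_def integrable_restrict_space)
  then have "set_integrable lebesgue {c<..<d} (\<lambda>t. norm (f t) powr p)"
    by (rule set_integrable_subset) (use assms in auto)
  moreover have "f \<in> borel_measurable (lebesgue_on {c<..<d})"
    using f by (intro measurable_restrict_mono[OF _ assms]) (simp add: Lp_def)
  ultimately show "f \<in> Lp p c d"
    by (simp add: Lp_def set_integrable_def integrable_restrict_space)
qed

lemma LpN_shift: "f \<in> LpN p a b \<Longrightarrow> (\<lambda>t. f (t - c)) \<in> LpN p (a + c) (b + c)"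
  by (auto simp: LpN_def intro: Lp_shift)

lemma LpN_subset: "f \<in> LpN p a b \<Longrightarrow> {c<..<d} \<subseteq> {a<..<b} \<Longrightarrow> f \<in> LpN p c d"
  using Lp_subset[of c d a b p] by (auto simp: LpN_def)

section \<open>A Gronwall-type inequality\<close>

lemma set_integral_exp_le:
  fixes a c t :: real
  assumes "c > 0" "a \<le> t"
  shows "(LINT \<xi>:{a<..<t}|lebesgue. exp (c * (\<xi> - a))) \<le> exp (c * (t - a)) / c"
proof -
  have "((\<lambda>\<xi>. exp (c * (\<xi> - a))) has_integral (exp (c * (t - a)) / c - exp (c * (a - a)) / c)) {a..t}"
    using assms by (intro fundamental_theorem_of_calculus[where f = "\<lambda>t. exp (c * (t - a)) / c"])
      (auto intro!: derivative_eq_intros simp: has_real_derivative_iff_has_vector_derivative[symmetric])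
  then have "integral {a<..<t} (\<lambda>\<xi>. exp (c * (\<xi> - a))) = (exp (c * (t - a)) - 1) / c"
    by (simp add: integral_open_interval_real[symmetric] integral_unique diff_divide_distrib)
  moreover have "set_integrable lebesgue {a<..<t} (\<lambda>\<xi>. exp (c * (\<xi> - a)))"
    by (rule set_integrable_subset[OF absolutely_integrable_continuous_real[of a t]])
      (auto intro!: continuous_intros)
  \<comment> \<open>The lower endpoint contributes \<open>- 1 / c\<close>, which is dropped.\<close>
  ultimately show ?thesis
    using assms by (simp add: set_lebesgue_integral_eq_integral(2) divide_right_mono)
qed

text \<open>A Gronwall argument for a function known only almost everywhere: an exponential bound is
  fed back into the inequality repeatedly, and its constants tend to 0.\<close>

lemma Volterra_inequality_imp_AE_zero:
  fixes \<delta> :: "real \<Rightarrow> 'a::{banach, second_countable_topology}"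
  assumes int: "set_integrable lebesgue {a<..<b} \<delta>" and C: "C > 0"
    and le: "AE t in lebesgue. t \<in> {a<..<b} \<longrightarrow>
      norm (\<delta> t) \<le> C * (LINT \<xi>:{a<..<t}|lebesgue. norm (\<delta> \<xi>))"
  shows "AE t in lebesgue. t \<in> {a<..<b} \<longrightarrow> \<delta> t = 0"
proof -
  \<comment> \<open>The right-hand side of the hypothesis with the integral extended to all of
    \<open>{a<..<b}\<close>; it bounds \<open>norm (\<delta> t)\<close> almost everywhere and starts
    the induction.\<close>
  define M where "M = C * (LINT \<xi>:{a<..<b}|lebesgue. norm (\<delta> \<xi>))"
  have intn: "set_integrable lebesgue {a<..<t} (\<lambda>\<xi>. norm (\<delta> \<xi>))" if "t \<le> b" for t
    by (rule set_integrable_norm, rule set_integrable_subset[OF int]) (use that in auto)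
  \<comment> \<open>inserting an exponential bound of rate \<open>2C\<close> into the inequality halves its constant\<close>
  have bound: "AE t in lebesgue. t \<in> {a<..<b} \<longrightarrow> norm (\<delta> t) \<le> M / 2 ^ n * exp (2 * C * (t - a))" for n
  proof (induction n)
    case 0
    from le show ?case
    proof eventually_elim
      case (elim t)
      show ?case
      proof
        assume t: "t \<in> {a<..<b}"
        have "(LINT \<xi>:{a<..<t}|lebesgue. norm (\<delta> \<xi>)) \<le> (LINT \<xi>:{a<..<b}|lebesgue. norm (\<delta> \<xi>))"
          using intn[of b] intn[of t] t unfolding set_lebesgue_integral_def set_integrable_def
          by (intro integral_mono) (auto simp: indicator_def)
        with elim C t have "norm (\<delta> t) \<le> M" unfolding M_def
          by (meson less_imp_le mult_left_mono order_trans)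
        moreover have "M * 1 \<le> M * exp (2 * C * (t - a))"
          using C t by (intro mult_left_mono)
            (auto simp: M_def set_lebesgue_integral_def intro!: mult_nonneg_nonneg Bochner_Integration.integral_nonneg)
        ultimately show "norm (\<delta> t) \<le> M / 2 ^ 0 * exp (2 * C * (t - a))" by simp
      qed
    qed
  next
    case (Suc n)
    from le Suc.IH show ?case
    proof eventually_elim
      case (elim t)
      show ?case
      proof
        assume t: "t \<in> {a<..<b}"
        have e: "set_integrable lebesgue {a<..<t} (\<lambda>\<xi>. M / 2 ^ n * exp (2 * C * (\<xi> - a)))"
          by (rule set_integrable_subset[OF absolutely_integrable_continuous_real[of a t]])
            (auto intro!: continuous_intros)
        have "(LINT \<xi>:{a<..<t}|lebesgue. norm (\<delta> \<xi>)) \<le> (LINT \<xi>:{a<..<t}|lebesgue. M / 2 ^ n * exp (2 * C * (\<xi> - a)))"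
          using intn[of t] e Suc.IH t unfolding set_lebesgue_integral_def set_integrable_def
          by (intro integral_mono_AE) (auto simp: indicator_def elim!: eventually_mono)
        also have "\<dots> = M / 2 ^ n * (LINT \<xi>:{a<..<t}|lebesgue. exp (2 * C * (\<xi> - a)))"
          by simp
        also have "\<dots> \<le> M / 2 ^ n * (exp (2 * C * (t - a)) / (2 * C))"
          using C t by (intro mult_left_mono set_integral_exp_le divide_nonneg_nonneg)
            (auto simp: M_def set_lebesgue_integral_def intro!: mult_nonneg_nonneg Bochner_Integration.integral_nonneg)
        finally have "C * (LINT \<xi>:{a<..<t}|lebesgue. norm (\<delta> \<xi>)) \<le> M / 2 ^ Suc n * exp (2 * C * (t - a))"
          using C by (simp add: field_simps)
        with elim(1) t show "norm (\<delta> t) \<le> M / 2 ^ Suc n * exp (2 * C * (t - a))" by linarith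
      qed
    qed
  qed
  \<comment> \<open>Countably many exceptional null sets are merged, so that the limit in
    \<open>n\<close> can be taken at a fixed \<open>t\<close>.\<close>
  from bound have "AE t in lebesgue. \<forall>n. t \<in> {a<..<b} \<longrightarrow> norm (\<delta> t) \<le> M / 2 ^ n * exp (2 * C * (t - a))"
    unfolding AE_all_countable by blast
  then show ?thesis
  proof eventually_elim
    case (elim t)
    show ?case
    proof
      assume t: "t \<in> {a<..<b}"
      have "(\<lambda>n. M * (1 / 2) ^ n * exp (2 * C * (t - a))) \<longlonglongrightarrow> M * 0 * exp (2 * C * (t - a))"
        by (intro tendsto_intros LIMSEQ_power_zero) auto
      then have "(\<lambda>n. M / 2 ^ n * exp (2 * C * (t - a))) \<longlonglongrightarrow> 0" by (simp add: power_divide)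
      then have "norm (\<delta> t) \<le> 0" by (rule LIMSEQ_le_const) (use elim t in auto)
      then show "\<delta> t = 0" by simp
    qed
  qed
qed

section \<open>The Volterra operator\<close>

text \<open>The kernel of \<open>V_op\<close> with the lag and the vector as separate arguments, so
  that joint continuity, linearity and norm bounds can be proved once.\<close>

definition volt_kernel :: "real^'n^'n \<Rightarrow> real^'n^'n \<Rightarrow> real \<Rightarrow> complex^'n \<Rightarrow> complex^'n" where
  "volt_kernel A B t v = cmat (mexp (t *\<^sub>R B)) *v (cmat A *v v)"

lemma V_op_eq: "V_op T A B \<nu> \<theta> = (LINT \<xi>:{- T<..<\<theta>}|lebesgue. volt_kernel A B (\<xi> - \<theta>) (\<nu> \<xi>))"
  by (simp add: V_op_def volt_kernel_def)

lemma linear_volt_kernel: "linear (volt_kernel A B t)"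
  unfolding volt_kernel_def
  by (rule bounded_linear.linear[OF bounded_bilinear.bounded_linear_right[OF bounded_bilinear_kernel]])

lemma continuous_on_volt_kernel:
  assumes "continuous_on S f" "continuous_on S g"
  shows "continuous_on S (\<lambda>x. volt_kernel A B (f x) (g x))"
  unfolding volt_kernel_def
  by (intro bounded_bilinear.continuous_on[OF bounded_bilinear_kernel] assms
      continuous_on_compose2[OF continuous_on_mexp_line assms(1), of UNIV]) auto

text \<open>By continuity the matrix exponential is bounded on a compact range of lags, and the
  bilinear estimate turns this into one constant for all vectors.\<close>

lemma volt_kernel_bound:
  fixes A B :: "real^'n^'n"
  obtains C where "C > 0" "\<And>t v. \<bar>t\<bar> \<le> R \<Longrightarrow> norm (volt_kernel A B t v) \<le> C * norm v"
proof -
  obtain K where K: "K > 0" "\<And>(X::real^'n^'n) v. norm (cmat X *v (cmat A *v v)) \<le> norm X * norm v * K"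
    using bounded_bilinear.pos_bounded[OF bounded_bilinear_kernel[of A]] by blast
  have "bounded ((\<lambda>t. mexp (t *\<^sub>R B)) ` {- R..R})"
    by (intro compact_imp_bounded compact_continuous_image continuous_on_mexp_line) auto
  then obtain M where M: "M > 0" "\<And>t. t \<in> {- R..R} \<Longrightarrow> norm (mexp (t *\<^sub>R B)) \<le> M"
    unfolding bounded_pos by blast
  show ?thesis
  proof (rule that[of "M * K"])
    fix t and v :: "complex^'n" assume "\<bar>t\<bar> \<le> R"
    then have "norm (mexp (t *\<^sub>R B)) \<le> M" by (intro M(2)) auto
    then have "norm (mexp (t *\<^sub>R B)) * norm v * K \<le> M * norm v * K"
      using K(1) by (intro mult_right_mono) auto
    then show "norm (volt_kernel A B t v) \<le> M * K * norm v"
      using K(2)[of "mexp (t *\<^sub>R B)" v] by (simp add: volt_kernel_def ac_simps)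
  qed (use K M in auto)
qed

text \<open>Linearity moves the indicator inside the kernel, next to \<open>\<nu>\<close>. Joint
  continuity then gives measurability, and the kernel bound gives an integrable majorant.\<close>

lemma set_integrable_volt_kernel:
  assumes "set_integrable lebesgue {a<..<b} \<nu>"
  shows "set_integrable lebesgue {a<..<b} (\<lambda>\<xi>. volt_kernel A B (\<xi> - \<theta>) (\<nu> \<xi>))"
proof -
  \<comment> \<open>Chosen to bound the lag \<open>\<bar>\<xi> - \<theta>\<bar>\<close> for every
    \<open>\<xi>\<close> in \<open>{a<..<b}\<close>.\<close>
  define R where "R = \<bar>a - \<theta>\<bar> + \<bar>b - \<theta>\<bar>"
  obtain C where C: "C > 0" "\<And>t v. \<bar>t\<bar> \<le> R \<Longrightarrow> norm (volt_kernel A B t v) \<le> C * norm v"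
    using volt_kernel_bound[where R = R and A = A and B = B] by blast
  have "integrable lebesgue (\<lambda>\<xi>. volt_kernel A B (\<xi> - \<theta>) (indicator {a<..<b} \<xi> *\<^sub>R \<nu> \<xi>))"
  proof (rule Bochner_Integration.integrable_bound)
    show "integrable lebesgue (\<lambda>\<xi>. C * norm (indicator {a<..<b} \<xi> *\<^sub>R \<nu> \<xi>))"
      using assms by (intro integrable_mult_right integrable_norm) (simp add: set_integrable_def)
    show "(\<lambda>\<xi>. volt_kernel A B (\<xi> - \<theta>) (indicator {a<..<b} \<xi> *\<^sub>R \<nu> \<xi>)) \<in> borel_measurable lebesgue"
    proof (rule borel_measurable_continuous_Pair[where H = "volt_kernel A B"])
      show "(\<lambda>\<xi>. indicator {a<..<b} \<xi> *\<^sub>R \<nu> \<xi>) \<in> borel_measurable lebesgue"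
        using assms by (simp add: set_integrable_def)
      show "(\<lambda>\<xi>. \<xi> - \<theta>) \<in> borel_measurable lebesgue"
        by (intro measurable_completion) simp
      show "continuous_on UNIV (\<lambda>x. volt_kernel A B (fst x) (snd x))"
        by (intro continuous_on_volt_kernel continuous_intros)
    qed
    show "AE \<xi> in lebesgue. norm (volt_kernel A B (\<xi> - \<theta>) (indicator {a<..<b} \<xi> *\<^sub>R \<nu> \<xi>))
        \<le> norm (C * norm (indicator {a<..<b} \<xi> *\<^sub>R \<nu> \<xi>))"
    proof (rule AE_I2)
      fix \<xi>
      show "norm (volt_kernel A B (\<xi> - \<theta>) (indicator {a<..<b} \<xi> *\<^sub>R \<nu> \<xi>))
        \<le> norm (C * norm (indicator {a<..<b} \<xi> *\<^sub>R \<nu> \<xi>))"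
        using C(1) C(2)[of "\<xi> - \<theta>" "\<nu> \<xi>"] linear_0[OF linear_volt_kernel]
        by (cases "\<xi> \<in> {a<..<b}") (auto simp: R_def)
    qed
  qed
  then show ?thesis
    by (simp add: set_integrable_def linear_scale[OF linear_volt_kernel])
qed

lemma V_op_diff:
  assumes "set_integrable lebesgue {- T<..<0} \<nu>" "set_integrable lebesgue {- T<..<0} \<mu>" "\<theta> \<le> 0"
  shows "V_op T A B (\<lambda>t. \<nu> t - \<mu> t) \<theta> = V_op T A B \<nu> \<theta> - V_op T A B \<mu> \<theta>"
proof -
  have "set_integrable lebesgue {- T<..<\<theta>} f" if "set_integrable lebesgue {- T<..<0} f"
    for f :: "real \<Rightarrow> complex^'n"
    by (rule set_integrable_subset[OF that]) (use \<open>\<theta> \<le> 0\<close> in auto)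
  then show ?thesis unfolding V_op_eq linear_diff[OF linear_volt_kernel] using assms(1,2)
    by (intro set_integral_diff(2) set_integrable_volt_kernel)
qed

text \<open>All lags stay within \<open>T\<close>, so one kernel constant serves every
  \<open>\<nu>\<close> and \<open>\<theta>\<close>; this is the estimate behind the Volterra
  inequality.\<close>

lemma norm_V_op_le:
  fixes A B :: "real^'n^'n"
  obtains C where "C > 0"
    "\<And>\<nu> \<theta>. set_integrable lebesgue {- T<..<0} \<nu> \<Longrightarrow> - T \<le> \<theta> \<Longrightarrow> \<theta> \<le> 0 \<Longrightarrow>
      norm (V_op T A B \<nu> \<theta>) \<le> C * (LINT \<xi>:{- T<..<\<theta>}|lebesgue. norm (\<nu> \<xi>))"
proof -
  obtain C where C: "C > 0" "\<And>t v. \<bar>t\<bar> \<le> T \<Longrightarrow> norm (volt_kernel A B t v) \<le> C * norm v"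
    using volt_kernel_bound[where R = T and A = A and B = B] by blast
  show ?thesis
  proof (rule that[OF C(1)])
    fix \<nu> :: "real \<Rightarrow> complex^'n" and \<theta> assume int: "set_integrable lebesgue {- T<..<0} \<nu>" and \<theta>: "- T \<le> \<theta>" "\<theta> \<le> 0"
    have int': "set_integrable lebesgue {- T<..<\<theta>} \<nu>"
      by (rule set_integrable_subset[OF int]) (use \<theta> in auto)
    have "norm (V_op T A B \<nu> \<theta>) \<le> (LINT \<xi>:{- T<..<\<theta>}|lebesgue. norm (volt_kernel A B (\<xi> - \<theta>) (\<nu> \<xi>)))"
      unfolding V_op_eq by (intro set_integral_norm_bound set_integrable_volt_kernel int')
    also have "\<dots> \<le> (LINT \<xi>:{- T<..<\<theta>}|lebesgue. C * norm (\<nu> \<xi>))"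
      by (intro set_integral_mono set_integrable_norm set_integrable_volt_kernel int'
          set_integrable_mult_right C(2)) (use \<theta> in auto)
    finally show "norm (V_op T A B \<nu> \<theta>) \<le> C * (LINT \<xi>:{- T<..<\<theta>}|lebesgue. norm (\<nu> \<xi>))" by simp
  qed
qed

text \<open>Dominated convergence along a sequence of upper limits; the kernel bound for lags up to
  \<open>T\<close> supplies the majorant.\<close>

lemma continuous_on_V_op:
  assumes int: "set_integrable lebesgue {- T<..<0} \<nu>"
  shows "continuous_on {- T..0} (V_op T A B \<nu>)"
proof (rule continuous_on_sequentiallyI)
  fix \<theta> :: "nat \<Rightarrow> real" and l
  assume \<theta>: "\<forall>n. \<theta> n \<in> {- T..0}" and l: "l \<in> {- T..0}" and lim: "\<theta> \<longlonglongrightarrow> l"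
  obtain C where C: "C > 0" "\<And>t v. \<bar>t\<bar> \<le> T \<Longrightarrow> norm (volt_kernel A B t v) \<le> C * norm v"
    using volt_kernel_bound[where R = T and A = A and B = B] by blast
  have int': "set_integrable lebesgue {- T<..<t} \<nu>" if "t \<in> {- T..0}" for t
    by (rule set_integrable_subset[OF int]) (use that in auto)
  show "(\<lambda>n. V_op T A B \<nu> (\<theta> n)) \<longlonglongrightarrow> V_op T A B \<nu> l"
    unfolding V_op_eq set_lebesgue_integral_def
  proof (rule integral_dominated_convergence)
    show "(\<lambda>\<xi>. indicator {- T<..<l} \<xi> *\<^sub>R volt_kernel A B (\<xi> - l) (\<nu> \<xi>)) \<in> borel_measurable lebesgue"
      using set_integrable_volt_kernel[OF int'[OF l], of A B l] by (simp add: set_integrable_def)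
    show "(\<lambda>\<xi>. indicator {- T<..<\<theta> n} \<xi> *\<^sub>R volt_kernel A B (\<xi> - \<theta> n) (\<nu> \<xi>)) \<in> borel_measurable lebesgue" for n
      using set_integrable_volt_kernel[OF int', of "\<theta> n" A B "\<theta> n"] \<theta> by (simp add: set_integrable_def)
    show "integrable lebesgue (\<lambda>\<xi>. C * norm (indicator {- T<..<0} \<xi> *\<^sub>R \<nu> \<xi>))"
      using int by (intro integrable_mult_right integrable_norm) (simp add: set_integrable_def)
    show "AE \<xi> in lebesgue. norm (indicator {- T<..<\<theta> n} \<xi> *\<^sub>R volt_kernel A B (\<xi> - \<theta> n) (\<nu> \<xi>))
        \<le> C * norm (indicator {- T<..<0} \<xi> *\<^sub>R \<nu> \<xi>)" for n
    proof (rule AE_I2)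
      fix \<xi>
      have "\<theta> n \<in> {- T..0}" using \<theta> by blast
      then show "norm (indicator {- T<..<\<theta> n} \<xi> *\<^sub>R volt_kernel A B (\<xi> - \<theta> n) (\<nu> \<xi>))
        \<le> C * norm (indicator {- T<..<0} \<xi> *\<^sub>R \<nu> \<xi>)"
        using C(1) C(2)[of "\<xi> - \<theta> n" "\<nu> \<xi>"] by (auto simp: indicator_def)
    qed
    have "AE \<xi> in lebesgue. \<xi> \<noteq> l"
      by (rule AE_completion, rule AE_lborel_singleton)
    then show "AE \<xi> in lebesgue. (\<lambda>n. indicator {- T<..<\<theta> n} \<xi> *\<^sub>R volt_kernel A B (\<xi> - \<theta> n) (\<nu> \<xi>))
        \<longlonglongrightarrow> indicator {- T<..<l} \<xi> *\<^sub>R volt_kernel A B (\<xi> - l) (\<nu> \<xi>)"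
    proof eventually_elim
      case (elim \<xi>)
      have "continuous_on UNIV (\<lambda>t. volt_kernel A B (\<xi> - t) (\<nu> \<xi>))"
        by (intro continuous_on_volt_kernel continuous_intros)
      then have k: "(\<lambda>n. volt_kernel A B (\<xi> - \<theta> n) (\<nu> \<xi>)) \<longlonglongrightarrow> volt_kernel A B (\<xi> - l) (\<nu> \<xi>)"
        using lim by (rule continuous_on_tendsto_compose) auto
      \<comment> \<open>For \<open>\<xi>\<close> different from \<open>l\<close>, the points
        \<open>\<theta> n\<close> and \<open>l\<close> are eventually on the same side of
        \<open>\<xi>\<close>.\<close>
      have "\<forall>\<^sub>F n in sequentially. indicator {- T<..<\<theta> n} \<xi> = (indicator {- T<..<l} \<xi> :: real)"
      proof (cases "\<xi> < l")
        case True
        from order_tendstoD(1)[OF lim this] show ?thesis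
          by eventually_elim (use True in \<open>auto simp: indicator_def\<close>)
      next
        case False
        with elim have "l < \<xi>" by simp
        from order_tendstoD(2)[OF lim this] show ?thesis
          by eventually_elim (use False in \<open>auto simp: indicator_def\<close>)
      qed
      then have "(\<lambda>n. indicator {- T<..<\<theta> n} \<xi> :: real) \<longlonglongrightarrow> indicator {- T<..<l} \<xi>"
        by (rule tendsto_eventually)
      then show ?case by (intro tendsto_scaleR k)
    qed
  qed
qed

text \<open>Dividing the norm estimate for \<open>V_op\<close> by \<open>norm c\<close> gives
  exactly the hypothesis of the Volterra inequality.\<close>

lemma V_op_eigen_imp_AE_zero:
  assumes int: "set_integrable lebesgue {- T<..<0} \<delta>" and "c \<noteq> 0"
    and eq: "ae_eq (- T) 0 (\<lambda>\<theta>. c *s \<delta> \<theta>) (V_op T A B \<delta>)"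
  shows "ae_eq (- T) 0 \<delta> (\<lambda>_. 0)"
proof -
  obtain C where C: "C > 0"
    "\<And>\<nu> \<theta>. set_integrable lebesgue {- T<..<0} \<nu> \<Longrightarrow> - T \<le> \<theta> \<Longrightarrow> \<theta> \<le> 0 \<Longrightarrow>
      norm (V_op T A B \<nu> \<theta>) \<le> C * (LINT \<xi>:{- T<..<\<theta>}|lebesgue. norm (\<nu> \<xi>))"
    using norm_V_op_le[of T A B] by blast
  have ns: "norm (c *s v) = norm c * norm v" for v :: "complex^'n"
    by (simp add: norm_vec_def L2_set_def norm_mult power_mult_distrib sum_distrib_left[symmetric] real_sqrt_mult)
  show ?thesis unfolding ae_eq_iff
  proof (rule Volterra_inequality_imp_AE_zero[OF int, of "C / norm c"])
    show "AE t in lebesgue. t \<in> {- T<..<0} \<longrightarrow>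
        norm (\<delta> t) \<le> C / norm c * (LINT \<xi>:{- T<..<t}|lebesgue. norm (\<delta> \<xi>))"
      using eq[unfolded ae_eq_iff]
    proof eventually_elim
      case (elim t)
      show ?case
      proof
        assume t: "t \<in> {- T<..<0}"
        then have "norm c * norm (\<delta> t) = norm (V_op T A B \<delta> t)" using elim ns by metis
        also have "\<dots> \<le> C * (LINT \<xi>:{- T<..<t}|lebesgue. norm (\<delta> \<xi>))"
          using t by (intro C(2) int) auto
        finally show "norm (\<delta> t) \<le> C / norm c * (LINT \<xi>:{- T<..<t}|lebesgue. norm (\<delta> \<xi>))"
          using \<open>c \<noteq> 0\<close> by (simp add: field_simps)
      qed
    qed
  qed (use C \<open>c \<noteq> 0\<close> in auto)
qed

text \<open>The integral ignores null sets, so the value is determined at every single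
  \<open>\<theta>\<close>; in particular the value at 0 used in \<open>FF_op\<close> depends only on
  the class of \<open>\<nu>\<close>.\<close>

lemma V_op_cong_AE:
  assumes int: "set_integrable lebesgue {- T<..<0} \<nu>" "set_integrable lebesgue {- T<..<0} \<mu>"
    and eq: "ae_eq (- T) 0 \<nu> \<mu>" and "\<theta> \<le> 0"
  shows "V_op T A B \<nu> \<theta> = V_op T A B \<mu> \<theta>"
proof -
  have *: "set_integrable lebesgue {- T<..<\<theta>} f" if "set_integrable lebesgue {- T<..<0} f"
    for f :: "real \<Rightarrow> complex^'n"
    by (rule set_integrable_subset[OF that]) (use \<open>\<theta> \<le> 0\<close> in auto)
  show ?thesis
    unfolding V_op_eq set_lebesgue_integral_def
  proof (rule integral_cong_AE)
    show "(\<lambda>\<xi>. indicator {- T<..<\<theta>} \<xi> *\<^sub>R volt_kernel A B (\<xi> - \<theta>) (\<nu> \<xi>)) \<in> borel_measurable lebesgue"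
      "(\<lambda>\<xi>. indicator {- T<..<\<theta>} \<xi> *\<^sub>R volt_kernel A B (\<xi> - \<theta>) (\<mu> \<xi>)) \<in> borel_measurable lebesgue"
      using int[THEN *, THEN set_integrable_volt_kernel, of A B \<theta>] by (simp_all add: set_integrable_def)
    show "AE \<xi> in lebesgue. indicator {- T<..<\<theta>} \<xi> *\<^sub>R volt_kernel A B (\<xi> - \<theta>) (\<nu> \<xi>)
        = indicator {- T<..<\<theta>} \<xi> *\<^sub>R volt_kernel A B (\<xi> - \<theta>) (\<mu> \<xi>)"
      using eq[unfolded ae_eq_iff] by eventually_elim (use \<open>\<theta> \<le> 0\<close> in \<open>auto simp: indicator_def\<close>)
  qed
qed

section \<open>One-sided limit of the derivative of the periodic solution\<close>

text \<open>On a connected set a continuous function with finitely many values is constant, and the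
  hysteresis takes only the values 1 and -1.\<close>

lemma hyst_constant_on:
  assumes "\<And>t. t \<in> {a<..<b} \<Longrightarrow> isCont (hyst \<alpha> \<beta> g) t"
  obtains h where "\<And>t. t \<in> {a<..<b} \<Longrightarrow> hyst \<alpha> \<beta> g t = h"
proof -
  have "hyst \<alpha> \<beta> g ` {a<..<b} \<subseteq> {1, - 1}" by (auto simp: hyst_def)
  then have "finite (hyst \<alpha> \<beta> g ` {a<..<b})" by (rule finite_subset) simp
  then have "hyst \<alpha> \<beta> g constant_on {a<..<b}"
    using assms by (intro continuous_finite_range_constant continuous_at_imp_continuous_on) auto
  then show ?thesis using that by (auto simp: constant_on_def)
qed

text \<open>Regularity is bootstrapped: the integral equation makes \<open>u\<close> continuous, so
  its right-hand side \<open>G\<close> is continuous up to \<open>T\<close>, so \<open>u\<close> has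
  derivative \<open>G\<close> on \<open>(0,T)\<close>. A shift by \<open>2 * T\<close> carries this
  to \<open>\<phi>\<close>, and the limit is \<open>cvec (G T)\<close>.\<close>

lemma dphi_tendsto_at_left:
  assumes T: "T > 0" and p: "1 \<le> p"
    and per: "periodic_solution T \<sigma> s p \<alpha> \<beta> k A B m \<phi> x u"
  obtains l where "(dphi \<phi> \<longlongrightarrow> l) (at_left (- T))"
proof -
  define z where "z = hyst \<alpha> \<beta> (\<lambda>t. Mf m (u t))"
  have sol: "is_solution T p \<alpha> \<beta> k A B m \<phi> x u"
    and u\<phi>: "\<And>\<xi>. \<xi> \<in> {- 2 * T<..<0} \<Longrightarrow> u (2 * T + \<xi>) = \<phi> \<xi>"
    and disc: "{t \<in> {0<..2 * T}. \<not> isCont z t} = {T, 2 * T}"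
    using per by (simp_all add: periodic_solution_def Let_def z_def)
  \<comment> \<open>A jump inside \<open>(0,T)\<close> would be a discontinuity other than
    \<open>T\<close> and \<open>2 * T\<close>.\<close>
  have "isCont z t" if "t \<in> {0<..<T}" for t
  proof (rule ccontr)
    assume "\<not> isCont z t"
    with that T have "t \<in> {t \<in> {0<..2 * T}. \<not> isCont z t}" by simp
    with that T show False unfolding disc by auto
  qed
  then obtain h where h: "\<And>t. t \<in> {0<..<T} \<Longrightarrow> z t = h"
    using hyst_constant_on[of 0 T \<alpha> \<beta> "\<lambda>t. Mf m (u t)"] unfolding z_def by blast
  obtain g where W: "W1p_deriv p 0 T u g"
    and g: "AE t in lebesgue_on {0<..<T}. g t = z t *\<^sub>R k - B *v u t + A *v u (t - 2 * T)"
    using sol T unfolding is_solution_def z_def by blast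
  define G where "G t = h *\<^sub>R k - B *v u t + A *v u t" for t
  \<comment> \<open>The delayed time lies in the initial interval, where \<open>u\<close> equals
    \<open>\<phi>\<close>; periodicity then identifies this value with \<open>u t\<close>.\<close>
  have u_delay: "u (t - 2 * T) = u t" if "t \<in> {0<..<T}" for t
    using sol u\<phi>[of "t - 2 * T"] that T by (simp add: is_solution_def)
  have gG: "AE t in lebesgue. t \<in> {0<..<T} \<longrightarrow> g t = G t"
    using g by (simp add: AE_restrict_space_iff)
      (auto elim!: eventually_mono simp: h u_delay G_def)
  have int: "set_integrable lebesgue {0<..<t} g" if "t \<le> T" for t
    using W p that by (auto simp: W1p_deriv_def intro!: LpN_imp_set_integrable[of g p 0 T])
  have ug: "u t = u 0 + (LINT \<xi>:{0<..<t}|lebesgue. g \<xi>)" if "t \<in> {0..T}" for t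
    using W that unfolding W1p_deriv_def by blast
  have cont: "continuous_on {0..T} (\<lambda>t. u 0 + integral {0..t} g)"
    using set_lebesgue_integral_eq_integral(1)[OF int[OF order_refl]]
    by (intro continuous_intros indefinite_integral_continuous_1)
      (simp add: integrable_on_Icc_iff_Ioo)
  have "u t = u 0 + integral {0..t} g" if "t \<in> {0..T}" for t
    using ug[OF that] set_lebesgue_integral_eq_integral(2)[OF int] that
    by (simp add: integral_open_interval_real)
  then have u: "continuous_on {0..T} u"
    by (intro continuous_on_eq[OF cont]) (rule sym)
  then have G: "continuous_on {0..T} G" unfolding G_def
    by (intro continuous_intros bounded_linear.continuous_on[OF matrix_vector_mul_bounded_linear] u)
  \<comment> \<open>Replacing \<open>g\<close> by the continuous \<open>G\<close>, which differs
    from it on a null set only, makes the fundamental theorem of calculus applicable.\<close>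
  have uG: "u t = u 0 + integral {0..t} G" if t: "t \<in> {0..T}" for t
  proof -
    have iG: "set_integrable lebesgue {0<..<t} G"
      by (rule set_integrable_subset[OF absolutely_integrable_continuous_real[OF G]]) (use t in auto)
    have "(LINT \<xi>:{0<..<t}|lebesgue. g \<xi>) = (LINT \<xi>:{0<..<t}|lebesgue. G \<xi>)"
      unfolding set_lebesgue_integral_def
    proof (rule integral_cong_AE)
      show "AE \<xi> in lebesgue. indicator {0<..<t} \<xi> *\<^sub>R g \<xi> = indicator {0<..<t} \<xi> *\<^sub>R G \<xi>"
        using gG by eventually_elim (use t in \<open>auto simp: indicator_def\<close>)
    qed (use iG int[of t] t in \<open>auto simp: set_integrable_def\<close>)
    then show ?thesis
      using ug[OF t] set_lebesgue_integral_eq_integral(2)[OF iG] by (simp add: integral_open_interval_real)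
  qed
  have du: "(u has_vector_derivative G t) (at t)" if t: "t \<in> {0<..<T}" for t
  proof -
    have d: "((\<lambda>t. u 0 + integral {0..t} G) has_vector_derivative 0 + G t) (at t within {0..T})"
      using t by (intro derivative_intros integral_has_vector_derivative G) auto
    have "(u has_vector_derivative 0 + G t) (at t within {0..T})"
      by (rule has_vector_derivative_transform[OF _ uG d]) (use t in auto)
    then show ?thesis using t by (simp add: at_within_Icc_at)
  qed
  have d\<phi>: "dphi \<phi> \<xi> = cvec (G (2 * T + \<xi>))" if \<xi>: "\<xi> \<in> {- 2 * T<..<- T}" for \<xi>
  proof -
    have "((u \<circ> (\<lambda>\<xi>. 2 * T + \<xi>)) has_vector_derivative 1 *\<^sub>R G (2 * T + \<xi>)) (at \<xi>)"
      using \<xi> by (intro vector_diff_chain_at du) (auto intro!: derivative_eq_intros)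
    then have "(\<phi> has_vector_derivative 1 *\<^sub>R G (2 * T + \<xi>)) (at \<xi>)"
      by (rule has_vector_derivative_transform_within_open[of _ _ _ "{- 2 * T<..<- T}"])
        (use \<xi> u\<phi> T in auto)
    then show ?thesis by (simp add: dphi_def vector_derivative_at)
  qed
  have "continuous_on {- 2 * T..- T} (\<lambda>\<xi>. cvec (G (2 * T + \<xi>)))"
    unfolding cvec_def
    by (intro continuous_intros continuous_on_compose2[OF G]) auto
  then have "((\<lambda>\<xi>. cvec (G (2 * T + \<xi>))) \<longlongrightarrow> cvec (G (2 * T + - T))) (at (- T) within {- 2 * T..- T})"
    unfolding continuous_on_def by (drule_tac bspec[of _ _ "- T"]) (use T in auto)
  then have "((\<lambda>\<xi>. cvec (G (2 * T + \<xi>))) \<longlongrightarrow> cvec (G T)) (at_left (- T))"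
    using T by (simp add: at_within_Icc_at_left)
  moreover have "\<forall>\<^sub>F \<xi> in at_left (- T). cvec (G (2 * T + \<xi>)) = dphi \<phi> \<xi>"
    unfolding eventually_at_left_field using T d\<phi> by (intro exI[of _ "- 2 * T"]) auto
  ultimately show ?thesis
    by (intro that) (rule Lim_transform_eventually)
qed

section \<open>The eigenvalue problem\<close>

lemma Mf_add: "Mf m (a + b) = Mf m a + Mf m b"
  by (simp add: Mf_def scaleR_right_distrib sum.distrib)

text \<open>The integral in \<open>kappa\<close> is \<open>V_op\<close> at 0, so
  \<open>\<nu>1\<close> enters only through the vector \<open>V_op T A B \<nu>1 0\<close>. Hence
  \<open>V_op_cong_AE\<close> yields equal images, not just images equal almost everywhere.\<close>

lemma FF_op_eq:
  "FF_op T A B m i1 \<phi> ((\<nu>1, \<nu>2), z) =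
    (let \<kappa> = - (Mf m (V_op T A B \<nu>1 0) + Mf m (cmat (mexp (- T *\<^sub>R B)) *v DR m i1 z)) / Mf m (dphi_left T \<phi>);
         f2 = (\<lambda>\<theta>. \<kappa> *s dphi \<phi> (\<theta> - T) + cmat (mexp (- (\<theta> + T) *\<^sub>R B)) *v DR m i1 z)
     in ((\<lambda>\<theta>. \<kappa> *s dphi \<phi> \<theta>, f2), ER i1 (V_op T A B \<nu>1 0 + trace0 f2)))"
  by (simp add: FF_op_def kappa_def V_op_def)

lemma lam_minus_V_eq:
  "lam_minus_V T A B lam ((\<nu>1, \<nu>2), z) =
    ((\<lambda>\<theta>. lam *s \<nu>1 \<theta> - \<nu>2 \<theta>, \<lambda>\<theta>. lam *s \<nu>2 \<theta> - V_op T A B \<nu>1 \<theta>), lam *s z)"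
  by (simp add: lam_minus_V_def X_scale_def VV_op_def fun_eq_iff)

lemma X_eq_refl: "X_eq T w w"
  by (auto simp: X_eq_def ae_eq_def)

lemma X_eq_diff_zero_iff: "X_eq T (v - w) ((\<lambda>_. 0, \<lambda>_. 0), 0) \<longleftrightarrow> X_eq T v w"
  by (cases v; cases w) (auto simp: X_eq_def ae_eq_def)

lemma LpN_lincomb:
  fixes f g :: "real \<Rightarrow> complex^'n"
  assumes "f \<in> LpN p a b" "g \<in> LpN p a b" "1 \<le> p"
  shows "(\<lambda>t. c *s f t - g t) \<in> LpN p a b"
proof -
  have "(\<lambda>t. c * F t - G t) \<in> Lp p a b" if F: "F \<in> Lp p a b" and G: "G \<in> Lp p a b" for F G :: "real \<Rightarrow> complex"
  proof -
    have m: "(\<lambda>t. c * F t - G t) \<in> borel_measurable (lebesgue_on {a<..<b})"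
      using F G by (auto simp: Lp_def)
    have "integrable (lebesgue_on {a<..<b}) (\<lambda>t. norm (c * F t - G t) powr p)"
    proof (rule Bochner_Integration.integrable_bound)
      show "integrable (lebesgue_on {a<..<b}) (\<lambda>t. (2 * norm c) powr p * norm (F t) powr p + 2 powr p * norm (G t) powr p)"
        using F G by (auto simp: Lp_def)
      show "(\<lambda>t. norm (c * F t - G t) powr p) \<in> borel_measurable (lebesgue_on {a<..<b})"
        using m by measurable
      have "norm (norm (c * x - y) powr p) \<le> norm ((2 * norm c) powr p * norm x powr p + 2 powr p * norm y powr p)" for x y
      proof -
        \<comment> \<open>Passing to twice the larger term separates the two summands: the power of
          a maximum is one of the two powers.\<close>
        have "norm (c * x - y) \<le> max (2 * norm c * norm x) (2 * norm y)"
          using norm_triangle_ineq4[of "c * x" y] by (simp add: norm_mult max_def)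
        then have "norm (c * x - y) powr p \<le> max (2 * norm c * norm x) (2 * norm y) powr p"
          using assms(3) by (intro powr_mono2) auto
        also have "\<dots> \<le> (2 * norm c * norm x) powr p + (2 * norm y) powr p"
          by (simp add: max_def)
        finally show ?thesis by (simp add: powr_mult)
      qed
      then show "AE t in lebesgue_on {a<..<b}. norm (norm (c * F t - G t) powr p)
          \<le> norm ((2 * norm c) powr p * norm (F t) powr p + 2 powr p * norm (G t) powr p)"
        by simp
    qed
    with m show ?thesis by (simp add: Lp_def)
  qed
  then show ?thesis using assms by (auto simp: LpN_def)
qed

lemma V_op_in_LpN:
  assumes "\<nu> \<in> LpN p (- T) 0" "1 \<le> p"
  shows "V_op T A B \<nu> \<in> LpN p (- T) 0"
  using assms
  by (intro continuous_on_imp_LpN[OF continuous_on_V_op[OF LpN_imp_set_integrable[of \<nu> p "- T" 0]]]) auto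

lemma lam_minus_V_in_Xsp:
  assumes "w \<in> Xsp T p i1" "1 \<le> p"
  shows "lam_minus_V T A B lam w \<in> Xsp T p i1"
  using assms by (cases w) (auto simp: Xsp_def Zsp_def lam_minus_V_eq LpN_lincomb V_op_in_LpN)

text \<open>Two preimages under \<open>\<lambda>\<I> - \<V>\<close> differ in the first component by a \<open>\<delta>\<close> with \<open>\<lambda>\<^sup>2\<delta> = \<^bold>V\<delta>\<close>,
  and \<open>\<^bold>V\<close> is a Volterra operator.\<close>

lemma lam_minus_V_inj:
  assumes p: "1 \<le> p" and lam: "lam \<noteq> 0"
    and w: "((\<nu>1, \<nu>2), z) \<in> Xsp T p i1" "((\<mu>1, \<mu>2), y) \<in> Xsp T p i1"
    and eq: "X_eq T (lam_minus_V T A B lam ((\<nu>1, \<nu>2), z)) (lam_minus_V T A B lam ((\<mu>1, \<mu>2), y))"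
  shows "ae_eq (- T) 0 \<nu>1 \<mu>1" and "z = y"
proof -
  have int: "set_integrable lebesgue {- T<..<0} \<nu>1" "set_integrable lebesgue {- T<..<0} \<mu>1"
    using w p by (auto simp: Xsp_def intro!: LpN_imp_set_integrable[of _ p "- T" 0])
  define \<delta> where "\<delta> = (\<lambda>\<theta>. \<nu>1 \<theta> - \<mu>1 \<theta>)"
  have e1: "ae_eq (- T) 0 (\<lambda>\<theta>. lam *s \<nu>1 \<theta> - \<nu>2 \<theta>) (\<lambda>\<theta>. lam *s \<mu>1 \<theta> - \<mu>2 \<theta>)"
    and e2: "ae_eq (- T) 0 (\<lambda>\<theta>. lam *s \<nu>2 \<theta> - V_op T A B \<nu>1 \<theta>) (\<lambda>\<theta>. lam *s \<mu>2 \<theta> - V_op T A B \<mu>1 \<theta>)"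
    and z: "lam *s z = lam *s y"
    using eq by (simp_all add: lam_minus_V_eq X_eq_def)
  \<comment> \<open>The first row gives
    \<open>lam *s \<delta> \<theta> = \<nu>2 \<theta> - \<mu>2 \<theta>\<close>; inserted into the
    second row, it eliminates the second components.\<close>
  from e1 e2 have "ae_eq (- T) 0 (\<lambda>\<theta>. (lam * lam) *s \<delta> \<theta>) (V_op T A B \<delta>)"
    unfolding ae_eq_iff
  proof eventually_elim
    case (elim \<theta>)
    show ?case
    proof
      assume \<theta>: "\<theta> \<in> {- T<..<0}"
      with elim have 1: "lam *s \<delta> \<theta> = \<nu>2 \<theta> - \<mu>2 \<theta>"
        and 2: "lam *s (\<nu>2 \<theta> - \<mu>2 \<theta>) = V_op T A B \<nu>1 \<theta> - V_op T A B \<mu>1 \<theta>"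
        by (simp_all add: \<delta>_def vector_ssub_ldistrib algebra_simps)
      have "(lam * lam) *s \<delta> \<theta> = lam *s (lam *s \<delta> \<theta>)" by (simp add: vector_smult_assoc)
      also have "\<dots> = V_op T A B \<delta> \<theta>"
        using 1 2 V_op_diff[OF int, of \<theta> A B] \<theta> by (simp add: \<delta>_def)
      finally show "(lam * lam) *s \<delta> \<theta> = V_op T A B \<delta> \<theta>" .
    qed
  qed
  moreover have "set_integrable lebesgue {- T<..<0} \<delta>"
    unfolding \<delta>_def by (intro set_integral_diff(1) int)
  ultimately have "ae_eq (- T) 0 \<delta> (\<lambda>_. 0)"
    using lam by (intro V_op_eigen_imp_AE_zero[of T \<delta> "lam * lam"]) auto
  then show "ae_eq (- T) 0 \<nu>1 \<mu>1" by (simp add: ae_eq_def \<delta>_def)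
  show "z = y" using z lam by simp
qed

text \<open>The resolvent is a choice among preimages. \<open>w\<close> shows that one exists, and
  by injectivity the chosen one shares with \<open>w\<close> the vector part and, almost everywhere,
  the first component, which fix the image under \<open>FF_op\<close>.\<close>

lemma FF_op_resolvent_V:
  assumes p: "1 \<le> p" and lam: "lam \<noteq> 0" and w: "w \<in> Xsp T p i1"
  shows "FF_op T A B m i1 \<phi> (resolvent_V T p A B i1 lam (lam_minus_V T A B lam w)) = FF_op T A B m i1 \<phi> w"
proof -
  define w' where "w' = resolvent_V T p A B i1 lam (lam_minus_V T A B lam w)"
  have w': "w' \<in> Xsp T p i1 \<and> X_eq T (lam_minus_V T A B lam w') (lam_minus_V T A B lam w)"
    unfolding w'_def resolvent_V_def by (rule someI[of _ w]) (simp add: w X_eq_refl)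
  obtain \<nu>1 \<nu>2 z where ws: "w = ((\<nu>1, \<nu>2), z)" by (metis prod.exhaust)
  obtain \<mu>1 \<mu>2 y where ws': "w' = ((\<mu>1, \<mu>2), y)" by (metis prod.exhaust)
  have "ae_eq (- T) 0 \<mu>1 \<nu>1" and y: "y = z"
    using lam_minus_V_inj[OF p lam, of \<mu>1 \<mu>2 y T i1 \<nu>1 \<nu>2 z A B] w w' ws ws' by auto
  then have "V_op T A B \<mu>1 0 = V_op T A B \<nu>1 0"
    using w w' p unfolding ws ws'
    by (intro V_op_cong_AE) (auto simp: Xsp_def intro!: LpN_imp_set_integrable[of _ p "- T" 0])
  then show ?thesis
    unfolding w'_def[symmetric] by (simp add: ws ws' FF_op_eq y)
qed

text \<open>On each half of the interval \<open>L_op\<close> is a component of \<open>VV_op\<close>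
  plus one of \<open>FF_op\<close>, after the left half is shifted. The vector component needs the
  trace at 0 to split likewise, and \<open>lim\<close> ensures this.\<close>

lemma eigenpair_L_Pi_iff:
  assumes T: "T > 0" and p: "1 \<le> p"
    and lim: "(dphi \<phi> \<longlongrightarrow> l) (at_left (- T))"
    and \<nu>: "(\<nu>, z) \<in> Bsp T \<sigma> s p \<times> Zsp i1" "\<not> BZ_eq T (\<nu>, z) (\<lambda>_. 0, 0)"
  shows "eigenpair_L_Pi T \<sigma> s p A B m i1 \<phi> lam (\<nu>, z) \<longleftrightarrow>
    X_eq T (lam_minus_V T A B lam (U_op T \<nu>, z)) (FF_op T A B m i1 \<phi> (U_op T \<nu>, z))"
proof -
  define \<nu>1 where "\<nu>1 \<theta> = \<nu> (\<theta> - T)" for \<theta>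
  define \<kappa> where "\<kappa> = kappa T A B m i1 \<phi> \<nu>1 z"
  define f2 where "f2 = (\<lambda>\<theta>. \<kappa> *s dphi \<phi> (\<theta> - T) + cmat (mexp (- (\<theta> + T) *\<^sub>R B)) *v DR m i1 z)"
  define L where "L = L_op T A B m \<phi> \<nu> (DR m i1 z)"
  have int: "set_integrable lebesgue {- T<..<0} \<nu>1"
  proof -
    have "\<nu> \<in> LpN p (- 2 * T) (- T)"
      by (rule LpN_subset[of _ _ "- 2 * T" 0]) (use \<nu> T in \<open>auto simp: Bsp_def\<close>)
    from LpN_shift[OF this, of T] show ?thesis
      unfolding \<nu>1_def using p by (intro LpN_imp_set_integrable[of _ p "- T" 0]) auto
  qed
  \<comment> \<open>Additivity of \<open>Mf\<close> turns the single argument in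
    \<open>c_coef\<close> into the two terms of \<open>kappa\<close>.\<close>
  have c: "c_coef T A B m \<phi> \<nu> (DR m i1 z) = \<kappa>"
    by (simp add: c_coef_def \<kappa>_def kappa_def Mf_add \<nu>1_def)
  have L1: "L (\<theta> - T) = \<kappa> *s dphi \<phi> \<theta> + \<nu> \<theta>" if "\<theta> \<in> {- T<..<0}" for \<theta>
    using that by (simp add: L_def L_op_def c)
  have L2: "L \<theta> = V_op T A B \<nu>1 \<theta> + f2 \<theta>" if "\<theta> \<in> {- T<..<0}" for \<theta>
    using that by (simp add: L_def L_op_def c f2_def V_op_def \<nu>1_def add.assoc add.left_commute)
  \<comment> \<open>As \<open>\<theta>\<close> tends to 0 from the left, \<open>\<theta> - T\<close>
    tends to \<open>- T\<close> from the left, so \<open>lim\<close> governs the trace of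
    \<open>f2\<close>.\<close>
  have "(dphi \<phi> \<longlongrightarrow> l) (filtermap (\<lambda>\<theta>. \<theta> - T) (at_left 0))"
    using lim by (simp add: filtermap_at_left_shift)
  then have "((\<lambda>\<theta>. dphi \<phi> (\<theta> - T)) \<longlongrightarrow> l) (at_left 0)"
    by (simp add: filterlim_filtermap)
  moreover have "((\<lambda>\<theta>. cmat (mexp (- (\<theta> + T) *\<^sub>R B)) *v DR m i1 z) \<longlongrightarrow> cmat (mexp (- (0 + T) *\<^sub>R B)) *v DR m i1 z) (at_left 0)"
  proof -
    have "continuous_on UNIV (\<lambda>\<theta>. cmat (mexp (- (\<theta> + T) *\<^sub>R B)) *v DR m i1 z)"
      by (intro bounded_bilinear.continuous_on[OF bounded_bilinear_cmat_mult] continuous_intros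
          continuous_on_compose2[OF continuous_on_mexp_line, of UNIV]) auto
    from this[unfolded continuous_on_def, THEN bspec, OF UNIV_I, of 0] show ?thesis
      by (rule tendsto_within_subset) simp
  qed
  ultimately obtain l2 where l2: "(f2 \<longlongrightarrow> l2) (at_left 0)"
  proof -
    assume 1: "((\<lambda>\<theta>. dphi \<phi> (\<theta> - T)) \<longlongrightarrow> l) (at_left 0)"
      and 2: "((\<lambda>\<theta>. cmat (mexp (- (\<theta> + T) *\<^sub>R B)) *v DR m i1 z) \<longlongrightarrow> cmat (mexp (- (0 + T) *\<^sub>R B)) *v DR m i1 z) (at_left 0)"
    have "bounded_linear ((*s) \<kappa> :: complex^'a \<Rightarrow> complex^'a)"
      by (simp add: linear_conv_bounded_linear[symmetric] linear_iff vec_eq_iff algebra_simps)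
    from bounded_linear.tendsto[OF this 1]
    have "(f2 \<longlongrightarrow> \<kappa> *s l + cmat (mexp (- (0 + T) *\<^sub>R B)) *v DR m i1 z) (at_left 0)"
      unfolding f2_def by (intro tendsto_add 2)
    then show ?thesis by (rule that)
  qed
  \<comment> \<open>By continuity the trace of the Volterra part is its value at 0; since
    \<open>f2\<close> also has a limit, the trace of \<open>L\<close> is the sum.\<close>
  have "(V_op T A B \<nu>1 \<longlongrightarrow> V_op T A B \<nu>1 0) (at 0 within {- T..0})"
    using continuous_on_V_op[OF int] T by (auto simp: continuous_on_def)
  then have V0: "(V_op T A B \<nu>1 \<longlongrightarrow> V_op T A B \<nu>1 0) (at_left 0)"
    using T by (simp add: at_within_Icc_at_left)
  have "\<forall>\<^sub>F \<theta> in at_left 0. V_op T A B \<nu>1 \<theta> + f2 \<theta> = L \<theta>"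
    unfolding eventually_at_left_field using T L2 by (intro exI[of _ "- T"]) auto
  with tendsto_add[OF V0 l2] have "(L \<longlongrightarrow> V_op T A B \<nu>1 0 + l2) (at_left 0)"
    by (rule Lim_transform_eventually)
  then have "trace0 L = V_op T A B \<nu>1 0 + l2" unfolding trace0_def
    by (intro tendsto_Lim) auto
  moreover have "trace0 f2 = l2" unfolding trace0_def
    by (intro tendsto_Lim l2) auto
  ultimately have tr: "trace0 L = V_op T A B \<nu>1 0 + trace0 f2" by simp
  have "eigenpair_L_Pi T \<sigma> s p A B m i1 \<phi> lam (\<nu>, z) \<longleftrightarrow>
      ae_eq (- 2 * T) 0 L (\<lambda>\<theta>. lam *s \<nu> \<theta>) \<and> ER i1 (trace0 L) = lam *s z"
    using \<nu> by (simp add: eigenpair_L_Pi_def BZ_eq_def L_Pi_def L_def)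
  \<comment> \<open>The interval is cut at the null set \<open>{- T}\<close> and its left half is
    translated to \<open>(-T,0)\<close>.\<close>
  also have "ae_eq (- 2 * T) 0 L (\<lambda>\<theta>. lam *s \<nu> \<theta>) \<longleftrightarrow>
      ae_eq (- T) 0 (\<lambda>\<theta>. L (\<theta> - T)) (\<lambda>\<theta>. lam *s \<nu> (\<theta> - T)) \<and> ae_eq (- T) 0 L (\<lambda>\<theta>. lam *s \<nu> \<theta>)"
    using T ae_eq_split[of "- 2 * T" "- T" 0 L "\<lambda>\<theta>. lam *s \<nu> \<theta>"]
      ae_eq_shift[of "- T" 0 L T "\<lambda>\<theta>. lam *s \<nu> \<theta>"] by simp
  \<comment> \<open>Rearranging leaves \<open>lam_minus_V\<close> on the left and
    \<open>FF_op\<close> on the right, here and for the second component.\<close>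
  also have "ae_eq (- T) 0 (\<lambda>\<theta>. L (\<theta> - T)) (\<lambda>\<theta>. lam *s \<nu> (\<theta> - T)) \<longleftrightarrow>
      ae_eq (- T) 0 (\<lambda>\<theta>. lam *s \<nu>1 \<theta> - \<nu> \<theta>) (\<lambda>\<theta>. \<kappa> *s dphi \<phi> \<theta>)"
    unfolding ae_eq_iff by (intro AE_cong) (auto simp: L1 \<nu>1_def algebra_simps)
  also have "ae_eq (- T) 0 L (\<lambda>\<theta>. lam *s \<nu> \<theta>) \<longleftrightarrow>
      ae_eq (- T) 0 (\<lambda>\<theta>. lam *s \<nu> \<theta> - V_op T A B \<nu>1 \<theta>) f2"
    unfolding ae_eq_iff by (intro AE_cong) (auto simp: L2 algebra_simps)
  finally have "eigenpair_L_Pi T \<sigma> s p A B m i1 \<phi> lam (\<nu>, z) \<longleftrightarrow>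
      X_eq T (lam_minus_V T A B lam ((\<nu>1, \<nu>), z))
        ((\<lambda>\<theta>. \<kappa> *s dphi \<phi> \<theta>, f2), ER i1 (V_op T A B \<nu>1 0 + trace0 f2))"
    by (simp add: lam_minus_V_eq X_eq_def tr eq_commute)
  also have "((\<lambda>\<theta>. \<kappa> *s dphi \<phi> \<theta>, f2), ER i1 (V_op T A B \<nu>1 0 + trace0 f2)) =
      FF_op T A B m i1 \<phi> ((\<nu>1, \<nu>), z)"
    by (simp add: FF_op_def Let_def \<kappa>_def f2_def)
  finally show ?thesis by (simp add: U_op_def \<nu>1_def[abs_def])
qed

theorem theorem6p9:
  fixes T \<sigma> s p \<alpha> \<beta> :: real
    and k m x\<^sub>\<alpha> :: "real^'n" and A B :: "real^'n^'n" and i1 :: 'n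
    and \<phi>\<^sub>\<alpha> u\<^sub>p\<^sub>e\<^sub>r :: "real \<Rightarrow> real^'n"
    and lam :: complex and \<nu> :: "real \<Rightarrow> complex^'n" and z :: "complex^'n"
  assumes "T > 0" and "\<alpha> < \<beta>" and "m $ i1 \<noteq> 0"
    and "0 < s" and "s < 1" and "1 < p" and "p < min (1 / s) (1 / (1 - s))"
    and "0 < \<sigma>" and "\<sigma> \<le> T / 3"
    and "periodic_solution T \<sigma> s p \<alpha> \<beta> k A B m \<phi>\<^sub>\<alpha> x\<^sub>\<alpha> u\<^sub>p\<^sub>e\<^sub>r"
    and "lam \<noteq> 0"
    and "(\<nu>, z) \<in> Bsp T \<sigma> s p \<times> Zsp i1" and "\<not> BZ_eq T (\<nu>, z) (\<lambda>_. 0, 0)"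
  shows "eigenpair_L_Pi T \<sigma> s p A B m i1 \<phi>\<^sub>\<alpha> lam (\<nu>, z) \<longleftrightarrow>
         lam_minus_V T A B lam (U_op T \<nu>, z) \<in> Ker_MM T p A B m i1 \<phi>\<^sub>\<alpha> lam"
proof -
  have p: "1 \<le> p" using assms by simp
  define w where "w = (U_op T \<nu>, z)"
  define \<rho> where "\<rho> = lam_minus_V T A B lam w"
  obtain l where "(dphi \<phi>\<^sub>\<alpha> \<longlongrightarrow> l) (at_left (- T))"
    using dphi_tendsto_at_left[OF \<open>T > 0\<close> p assms(10)] by blast
  then have eig: "eigenpair_L_Pi T \<sigma> s p A B m i1 \<phi>\<^sub>\<alpha> lam (\<nu>, z) \<longleftrightarrow> X_eq T \<rho> (FF_op T A B m i1 \<phi>\<^sub>\<alpha> w)"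
    unfolding \<rho>_def w_def by (rule eigenpair_L_Pi_iff[OF \<open>T > 0\<close> p _ assms(12,13)])
  \<comment> \<open>Both components of \<open>w\<close> come from restrictions of
    \<open>\<nu>\<close> to a half of the interval, the first one translated by
    \<open>T\<close>.\<close>
  have "\<nu> \<in> LpN p (- 2 * T) 0" using assms(12) by (simp add: Bsp_def)
  then have "\<nu> \<in> LpN p (- T) 0" "\<nu> \<in> LpN p (- 2 * T) (- T)"
    using \<open>T > 0\<close> by (auto elim!: LpN_subset)
  then have w: "w \<in> Xsp T p i1"
    using assms(12) LpN_shift[of \<nu> p "- 2 * T" "- T" T] by (simp add: w_def U_op_def Xsp_def)
  then have "\<rho> \<in> Xsp T p i1" unfolding \<rho>_def by (rule lam_minus_V_in_Xsp[OF _ p])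
  \<comment> \<open>\<open>MM_op\<close> vanishes at \<open>\<rho>\<close> exactly when
    \<open>\<rho>\<close> equals \<open>FF_op\<close> of \<open>w\<close> in the sense of
    \<open>X_eq\<close>, and then \<open>w\<close> itself witnesses that \<open>\<rho>\<close> lies
    in the range.\<close>
  then show ?thesis
    unfolding eig w_def[symmetric] \<rho>_def[symmetric]
    using w FF_op_resolvent_V[OF p \<open>lam \<noteq> 0\<close> w, of A B m \<phi>\<^sub>\<alpha>]
    by (auto simp: Ker_MM_def Range_FF_def MM_op_def X_eq_diff_zero_iff \<rho>_def[symmetric])
qed

end
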